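(* Let $0\ne f\in\langle x_1,\dots,x_n\rangle\lhd\mathbb{C}\{x_1,\dots,x_n\}$ and $X=V(f)$. If the singular locus $\operatorname{Sing}X$ is quasihomogeneous, then $f$ is strongly Euler homogeneous, i.e. $f\in\langle x_1,\dots,x_n\rangle\cdot\mathcal J_f$ where $\mathcal J_f=\langle \partial f/\partial x_1,\dots,\partial f/\partial x_n\rangle$.
   Context: $\operatorname{Sing}X$ is the space germ with local algebra $\mathcal O_{\operatorname{Sing}X}=\mathbb{C}\{x_1,\dots,x_n\}/\tilde{\mathcal J}_f$, where $\tilde{\mathcal J}_f=\langle \partial f/\partial x_1,\dots,\partial f/\partial x_n,f\rangle$. A space germ with local analytic algebra $(\mathcal O,\mathfrak m)$ is quasihomogeneous if there exist minimal generators $y_1,\dots,y_m$ of $\mathfrak m$, positive rationals $w_1,\dots,w_m$ and a $\mathbb{C}$-linear derivation $\chi:\mathcal O\to\mathcal O$ with $\chi(y_i)=w_iy_i$ for all $i$ (an Euler derivation $\chi=\sum_i w_iy_i\,\partial/\partial y_i$). *)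

theory Defs
  imports "HOL-Analysis.Analysis"
begin

text \<open>Elements of the ring C{x_1,...,x_n} are represented by functions
  complex^'n \<Rightarrow> complex that are given near 0 by a convergent power series;
  two such functions represent the same element iff they agree near 0.\<close>

definition cps :: "(complex^'n::finite \<Rightarrow> complex) \<Rightarrow> bool" where
  "cps g \<longleftrightarrow> (\<exists>(c :: ('n \<Rightarrow> nat) \<Rightarrow> complex) e. e > 0 \<and>
     (\<forall>z. norm z < e \<longrightarrow>
        ((\<lambda>\<alpha>. c \<alpha> * (\<Prod>i\<in>UNIV. (z $ i) ^ \<alpha> i)) has_sum g z) UNIV))"

definition pd :: "'n::finite \<Rightarrow> (complex^'n \<Rightarrow> complex) \<Rightarrow> (complex^'n \<Rightarrow> complex)" where
  "pd i g = (\<lambda>z. deriv (\<lambda>t::complex. g (z + t *s axis i 1)) 0)"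

definition ideal_gen :: "(complex^'n::finite \<Rightarrow> complex) set \<Rightarrow> (complex^'n \<Rightarrow> complex) \<Rightarrow> bool" where
  "ideal_gen S g \<longleftrightarrow> (\<exists>F a. finite F \<and> F \<subseteq> S \<and> (\<forall>h\<in>F. cps (a h)) \<and>
      (\<forall>\<^sub>F z in nhds 0. g z = (\<Sum>h\<in>F. a h z * h z)))"

definition max_ideal :: "(complex^'n::finite \<Rightarrow> complex) set" where
  "max_ideal = {g. cps g \<and> g 0 = 0}"

definition congr :: "(complex^'n::finite \<Rightarrow> complex) set \<Rightarrow> (complex^'n \<Rightarrow> complex) \<Rightarrow> (complex^'n \<Rightarrow> complex) \<Rightarrow> bool" where
  "congr S g h \<longleftrightarrow> ideal_gen S (\<lambda>z. g z - h z)"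

text \<open>ys (representatives) generate the maximal ideal of C{x}/<S>.\<close>
definition gens_max :: "(complex^'n::finite \<Rightarrow> complex) set \<Rightarrow> (complex^'n \<Rightarrow> complex) list \<Rightarrow> bool" where
  "gens_max S ys \<longleftrightarrow> (\<forall>y\<in>set ys. y \<in> max_ideal) \<and> (\<forall>g\<in>max_ideal. ideal_gen (S \<union> set ys) g)"

definition min_gens_max :: "(complex^'n::finite \<Rightarrow> complex) set \<Rightarrow> (complex^'n \<Rightarrow> complex) list \<Rightarrow> bool" where
  "min_gens_max S ys \<longleftrightarrow> gens_max S ys \<and> (\<forall>zs. gens_max S zs \<longrightarrow> length ys \<le> length zs)"

text \<open>A C-linear derivation of C{x}/<S>, given on representatives.\<close>
definition quot_derivation :: "(complex^'n::finite \<Rightarrow> complex) set \<Rightarrow>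
    ((complex^'n \<Rightarrow> complex) \<Rightarrow> (complex^'n \<Rightarrow> complex)) \<Rightarrow> bool" where
  "quot_derivation S D \<longleftrightarrow>
     (\<forall>g. cps g \<longrightarrow> cps (D g)) \<and>
     (\<forall>g h. cps g \<longrightarrow> cps h \<longrightarrow> congr S g h \<longrightarrow> congr S (D g) (D h)) \<and>
     (\<forall>g h. cps g \<longrightarrow> cps h \<longrightarrow> congr S (D (\<lambda>z. g z + h z)) (\<lambda>z. D g z + D h z)) \<and>
     (\<forall>c g. cps g \<longrightarrow> congr S (D (\<lambda>z. c * g z)) (\<lambda>z. c * D g z)) \<and>
     (\<forall>g h. cps g \<longrightarrow> cps h \<longrightarrow>
        congr S (D (\<lambda>z. g z * h z)) (\<lambda>z. g z * D h z + h z * D g z))"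

text \<open>The space germ with local algebra C{x}/<S> is quasihomogeneous.\<close>
definition quasihomogeneous :: "(complex^'n::finite \<Rightarrow> complex) set \<Rightarrow> bool" where
  "quasihomogeneous S \<longleftrightarrow> (\<exists>ys (w :: nat \<Rightarrow> real) D.
     min_gens_max S ys \<and> (\<forall>i<length ys. w i \<in> \<rat> \<and> w i > 0) \<and>
     quot_derivation S D \<and>
     (\<forall>i<length ys. congr S (D (ys ! i)) (\<lambda>z. complex_of_real (w i) * (ys ! i) z)))"

definition sing_gens :: "(complex^'n::finite \<Rightarrow> complex) \<Rightarrow> (complex^'n \<Rightarrow> complex) set" where
  "sing_gens f = insert f (range (\<lambda>i. pd i f))"

definition strongly_euler_homogeneous :: "(complex^'n::finite \<Rightarrow> complex) \<Rightarrow> bool" where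
  "strongly_euler_homogeneous f \<longleftrightarrow>
     ideal_gen {(\<lambda>z. z $ j * pd i f z) | i j. True} f"

end

theory Submission
  imports Defs "HOL-Library.Function_Algebras" "HOL-Library.Ramsey"
    "HOL-Complex_Analysis.Cauchy_Integral_Formula"
begin

text \<open>
  Let \<open>I = \<langle>\<partial>\<^sub>1f, \<dots>, \<partial>\<^sub>nf, f\<rangle>\<close> and let \<open>m\<close> be the maximal ideal of \<open>C{x}\<close>. If some \<open>\<partial>\<^sub>if\<close> is a unit,
  then \<open>I\<close> is the whole ring and \<open>f \<in> m I\<close> is clear. Otherwise an Euler derivation of \<open>C{x}/I\<close> lifts
  to a vector field \<open>\<chi> = \<Sum> a\<^sub>i \<partial>\<^sub>i\<close> with \<open>\<chi> I \<subseteq> I\<close>, and changing the \<open>a\<^sub>i\<close> by elements of \<open>I\<close> one can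
  arrange that \<open>a\<^sub>i \<in> m\<close> and that \<open>\<chi>\<close> acts on \<open>m/m\<^sup>2\<close> diagonalisably with positive eigenvalues. Then
  every element of \<open>m\<close> is mapped into \<open>m\<^sup>k\<close> by some product of operators \<open>\<chi> - l\<close> with \<open>l > 0\<close>.
  The space \<open>A = {g. \<forall>j. \<partial>\<^sub>j g \<in> I}\<close> contains \<open>f\<close>, is stable under \<open>\<chi>\<close>, and \<open>\<chi> A \<subseteq> m I\<close>; so on
  \<open>A\<close> each factor \<open>\<chi> - l\<close> is multiplication by \<open>- l \<noteq> 0\<close> modulo \<open>m I\<close>, and \<open>f \<in> m I + m\<^sup>k\<close> for
  every \<open>k\<close>. Krull's intersection theorem yields \<open>f \<in> m I\<close>, and Nakayama's lemma removes the
  generator \<open>f\<close> of \<open>I\<close>.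

  Krull's theorem for \<open>C{x}\<close> is proved with standard bases. Exponents \<open>\<alpha>\<close> are ordered by
  \<open>p\<^sub>1^\<alpha>\<^sub>1 \<cdots> p\<^sub>n^\<alpha>\<^sub>n\<close> for distinct primes \<open>p\<^sub>i\<close>, and convergence is measured on the polydisc of radii
  \<open>p\<^sub>i^(-s)\<close>: for large \<open>s\<close> the leading term of a series dominates its tail, so division with
  remainder converges. A remainder has no exponent that leads an element of the ideal; but a nonzero
  remainder of an element of \<open>\<Inter>\<^sub>k (I + m\<^sup>k)\<close> agrees up to its leading exponent with an element of \<open>I\<close>.
\<close>

section \<open>Exponents and monomials\<close>

definition index_prime :: "'n::finite \<Rightarrow> nat" where
  "index_prime = (SOME p. inj p \<and> (\<forall>i. prime (p i)))"

lemma
  shows inj_index_prime: "inj (index_prime :: 'n::finite \<Rightarrow> nat)"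
    and prime_index_prime: "prime (index_prime (i :: 'n))"
proof -
  obtain h :: "'n \<Rightarrow> nat" where h: "bij_betw h UNIV {0..<CARD('n)}"
    using ex_bij_betw_finite_nat[of "UNIV :: 'n set"] by auto
  obtain e :: "nat \<Rightarrow> nat" where e: "inj e" "range e \<subseteq> {p. prime p}"
    using infinite_countable_subset[OF primes_infinite] by auto
  have "inj (e \<circ> h) \<and> (\<forall>i. prime ((e \<circ> h) i))"
    using h e by (auto intro!: inj_compose simp: bij_betw_def)
  then have "\<exists>p :: 'n \<Rightarrow> nat. inj p \<and> (\<forall>i. prime (p i))"
    by blast
  from someI_ex[OF this, folded index_prime_def]
  show "inj (index_prime :: 'n \<Rightarrow> nat)" "prime (index_prime i)"
    by auto
qed

lemma index_prime_ge_2: "2 \<le> index_prime i"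
  by (rule prime_ge_2_nat[OF prime_index_prime])

definition prime_code :: "('n::finite \<Rightarrow> nat) \<Rightarrow> nat" where
  "prime_code \<alpha> = (\<Prod>i\<in>UNIV. index_prime i ^ \<alpha> i)"

definition total_degree :: "('n::finite \<Rightarrow> nat) \<Rightarrow> nat" where
  "total_degree \<alpha> = (\<Sum>i\<in>UNIV. \<alpha> i)"

definition unit_exponent :: "'n \<Rightarrow> 'n \<Rightarrow> nat" where
  "unit_exponent i = (\<lambda>j. if j = i then 1 else 0)"

definition monom_at :: "complex^'n::finite \<Rightarrow> ('n \<Rightarrow> nat) \<Rightarrow> complex" where
  "monom_at z \<alpha> = (\<Prod>i\<in>UNIV. z $ i ^ \<alpha> i)"

lemma exponent_diff_add [simp]: "\<beta> \<le> \<alpha> \<Longrightarrow> \<alpha> - \<beta> + \<beta> = (\<alpha> :: 'n \<Rightarrow> nat)"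
  by (auto simp: fun_eq_iff le_fun_def)

lemma exponent_add_diff [simp]: "\<beta> \<le> \<alpha> \<Longrightarrow> \<beta> + (\<alpha> - \<beta>) = (\<alpha> :: 'n \<Rightarrow> nat)"
  by (auto simp: fun_eq_iff le_fun_def)

lemma exponent_le_add [simp]: "\<alpha> \<le> \<alpha> + (\<beta> :: 'n \<Rightarrow> nat)" "\<alpha> \<le> \<beta> + (\<alpha> :: 'n \<Rightarrow> nat)"
  by (auto simp: le_fun_def)

lemma finite_exponents_le: "finite {\<beta>. \<beta> \<le> (\<alpha> :: 'n::finite \<Rightarrow> nat)}"
proof -
  have "{\<beta>. \<beta> \<le> \<alpha>} \<subseteq> PiE UNIV (\<lambda>i. {..\<alpha> i})"
    by (auto simp: le_fun_def)
  then show ?thesis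
    by (rule finite_subset) (auto intro: finite_PiE)
qed

lemma total_degree_add: "total_degree (\<alpha> + \<beta>) = total_degree \<alpha> + total_degree \<beta>"
  by (simp add: total_degree_def sum.distrib)

lemma total_degree_unit_exponent [simp]: "total_degree (unit_exponent i) = 1"
  by (simp add: total_degree_def unit_exponent_def)

lemma total_degree_eq_0_iff [simp]: "total_degree \<alpha> = 0 \<longleftrightarrow> \<alpha> = 0"
  by (auto simp: total_degree_def fun_eq_iff)

lemma unit_exponent_le_iff: "unit_exponent i \<le> \<alpha> \<longleftrightarrow> 0 < \<alpha> i"
  by (auto simp: unit_exponent_def le_fun_def)

lemma prime_code_add: "prime_code (\<alpha> + \<beta>) = prime_code \<alpha> * prime_code \<beta>"
  by (simp add: prime_code_def power_add prod.distrib)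

lemma prime_code_pos: "0 < prime_code \<alpha>"
  unfolding prime_code_def by (intro prod_pos) (auto simp: prime_gt_0_nat prime_index_prime)

lemma multiplicity_index_prime_prime_code:
  fixes \<alpha> :: "'n::finite \<Rightarrow> nat"
  shows "multiplicity (index_prime i) (prime_code \<alpha>) = \<alpha> i"
proof -
  have "prime_code \<alpha> = (\<Prod>p\<in>range (index_prime :: 'n \<Rightarrow> nat). p ^ \<alpha> (inv index_prime p))"
    by (simp add: prime_code_def prod.reindex[OF inj_index_prime] inv_f_f[OF inj_index_prime])
  also have "multiplicity (index_prime i) \<dots> = \<alpha> i"
    using prime_index_prime
    by (subst multiplicity_prod_prime_powers) (auto simp: inv_f_f[OF inj_index_prime])
  finally show ?thesis .
qed

lemma inj_prime_code: "inj (prime_code :: ('n::finite \<Rightarrow> nat) \<Rightarrow> nat)"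
  by (rule injI, rule ext) (metis multiplicity_index_prime_prime_code)

lemma finite_prime_code_le: "finite {\<alpha> :: 'n::finite \<Rightarrow> nat. prime_code \<alpha> \<le> K}"
  using finite_vimageI[OF finite_atMost[of K] inj_prime_code] by (simp add: vimage_def)

lemma total_degree_less_prime_code: "total_degree \<alpha> < prime_code \<alpha>"
proof -
  have "2 ^ total_degree \<alpha> = (\<Prod>i\<in>UNIV. 2 ^ \<alpha> i :: nat)"
    by (simp add: total_degree_def power_sum)
  also have "\<dots> \<le> prime_code \<alpha>"
    unfolding prime_code_def using index_prime_ge_2 by (intro prod_mono) (auto intro: power_mono)
  finally show ?thesis
    using less_exp[of "total_degree \<alpha>"] by linarith
qed

lemma monom_at_add: "monom_at z (\<alpha> + \<beta>) = monom_at z \<alpha> * monom_at z \<beta>"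
  by (simp add: monom_at_def power_add prod.distrib)

lemma monom_at_0 [simp]: "monom_at z 0 = 1"
  by (simp add: monom_at_def)

lemma monom_at_unit_exponent [simp]: "monom_at z (unit_exponent i) = z $ i"
  by (simp add: monom_at_def unit_exponent_def if_distrib cong: if_cong)

lemma monom_at_remove: "monom_at z \<alpha> = z $ i ^ \<alpha> i * (\<Prod>j\<in>UNIV - {i}. z $ j ^ \<alpha> j)"
  unfolding monom_at_def by (rule prod.remove) auto

lemma monom_at_line_has_field_derivative:
  "((\<lambda>t. monom_at (z + t *s axis i 1) \<alpha>) has_field_derivative
     of_nat (\<alpha> i) * monom_at (z + t *s axis i 1) (\<alpha> - unit_exponent i)) (at t)"
proof -
  define P where "P = (\<Prod>j\<in>UNIV - {i}. z $ j ^ \<alpha> j)"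
  have "monom_at (z + t *s axis i 1) \<beta> = (z $ i + t) ^ \<beta> i * P"
    if "\<And>j. j \<noteq> i \<Longrightarrow> \<beta> j = \<alpha> j" for t \<beta>
    using that by (subst monom_at_remove[of _ _ i]) (auto simp: P_def axis_def intro!: prod.cong)
  then have "monom_at (z + t *s axis i 1) \<alpha> = (z $ i + t) ^ \<alpha> i * P"
      "monom_at (z + t *s axis i 1) (\<alpha> - unit_exponent i) = (z $ i + t) ^ (\<alpha> i - 1) * P" for t
    by (simp_all add: unit_exponent_def)
  then show ?thesis
    by (auto intro!: derivative_eq_intros)
qed

lemma tendsto_line: "((\<lambda>t. z + t *s axis i 1 :: complex^'n::finite) \<longlongrightarrow> z) (nhds 0)"
  by (rule vec_tendstoI) (auto simp: axis_def intro!: tendsto_eq_intros filterlim_ident)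

section \<open>Convergent power series\<close>

definition radius :: "nat \<Rightarrow> 'n::finite \<Rightarrow> real" where
  "radius s i = 1 / real (index_prime i) ^ s"

definition polydisc :: "nat \<Rightarrow> (complex^'n::finite) set" where
  "polydisc s = {z. \<forall>i. norm (z $ i) < radius s i}"

definition weight :: "nat \<Rightarrow> ('n::finite \<Rightarrow> nat) \<Rightarrow> real" where
  "weight s \<alpha> = (\<Prod>i\<in>UNIV. radius s i ^ \<alpha> i)"

lemma radius_pos: "0 < radius s i"
  using index_prime_ge_2[of i] by (simp add: radius_def)

lemma radius_tendsto_0: "(\<lambda>s. radius s i) \<longlonglongrightarrow> 0"
proof -
  have "(\<lambda>s. (1 / real (index_prime i)) ^ s) \<longlonglongrightarrow> 0"
    using index_prime_ge_2[of i] by (intro LIMSEQ_power_zero) auto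
  then show ?thesis
    by (simp add: radius_def power_one_over)
qed

lemma weight_add: "weight s (\<alpha> + \<beta>) = weight s \<alpha> * weight s \<beta>"
  by (simp add: weight_def power_add prod.distrib)

lemma weight_eq_prime_code: "weight s \<alpha> = (1 / real (prime_code \<alpha>)) ^ s"
  by (simp add: weight_def radius_def prime_code_def prod_power_distrib power_one_over prod_dividef
      flip: power_mult mult.commute[of s])

lemma weight_pos: "0 < weight s \<alpha>"
  by (simp add: weight_eq_prime_code prime_code_pos)

lemma weight_nonneg [simp]: "0 \<le> weight s \<alpha>"
  by (rule less_imp_le[OF weight_pos])

lemma open_polydisc: "open (polydisc s)"
  unfolding polydisc_def Collect_all_eq
  by (auto intro!: open_INT open_Collect_less continuous_intros)

lemma zero_in_polydisc: "0 \<in> polydisc s"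
  by (simp add: polydisc_def radius_pos)

lemma eventually_in_polydisc: "\<forall>\<^sub>F z in nhds 0. z \<in> polydisc s"
  using open_polydisc zero_in_polydisc by (auto simp: eventually_nhds)

lemma norm_monom_at_le: "z \<in> polydisc s \<Longrightarrow> norm (monom_at z \<alpha>) \<le> weight s \<alpha>"
  unfolding monom_at_def weight_def prod_norm[symmetric] norm_power
  by (intro prod_mono) (auto intro!: power_mono simp: polydisc_def less_imp_le)

definition represents :: "(('n::finite \<Rightarrow> nat) \<Rightarrow> complex) \<Rightarrow> (complex^'n \<Rightarrow> complex) \<Rightarrow> bool" where
  "represents c g \<longleftrightarrow> (\<forall>\<^sub>F z in nhds 0. ((\<lambda>\<alpha>. c \<alpha> * monom_at z \<alpha>) has_sum g z) UNIV)"

definition summable_at :: "nat \<Rightarrow> (('n::finite \<Rightarrow> nat) \<Rightarrow> complex) \<Rightarrow> bool" where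
  "summable_at s c \<longleftrightarrow> (\<lambda>\<alpha>. norm (c \<alpha>) * weight s \<alpha>) summable_on UNIV"

lemma cps_iff_represents: "cps g \<longleftrightarrow> (\<exists>c. represents c g)"
  unfolding cps_def represents_def monom_at_def eventually_nhds_metric dist_norm by simp

lemma represents_eventually_summable_at:
  fixes c :: "('n::finite \<Rightarrow> nat) \<Rightarrow> complex"
  assumes "represents c g"
  shows "\<forall>\<^sub>F s in sequentially. summable_at s c"
proof -
  define \<rho> where "\<rho> s = (\<chi> i::'n. complex_of_real (radius s i))" for s
  have "\<rho> \<longlonglongrightarrow> 0"
    using tendsto_of_real[OF radius_tendsto_0, where 'a = complex]
    by (intro vec_tendstoI) (simp add: \<rho>_def)
  then have "\<forall>\<^sub>F s in sequentially. ((\<lambda>\<alpha>. c \<alpha> * monom_at (\<rho> s) \<alpha>) has_sum g (\<rho> s)) UNIV"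
    using assms unfolding represents_def by (rule eventually_compose_filterlim[rotated])
  then show ?thesis
  proof eventually_elim
    case (elim s)
    then have "(\<lambda>\<alpha>. norm (c \<alpha> * monom_at (\<rho> s) \<alpha>)) summable_on UNIV"
      by (simp add: has_sum_imp_summable flip: summable_on_iff_abs_summable_on_complex)
    moreover have "norm (monom_at (\<rho> s) \<alpha>) = weight s \<alpha>" for \<alpha>
      by (simp add: monom_at_def weight_def \<rho>_def prod_norm[symmetric] norm_power radius_pos
          less_imp_le)
    ultimately show ?case
      by (simp add: summable_at_def norm_mult)
  qed
qed

lemma summable_at_has_sum:
  assumes "summable_at s c" "z \<in> polydisc s"
  shows "((\<lambda>\<alpha>. c \<alpha> * monom_at z \<alpha>) has_sum (\<Sum>\<^sub>\<infinity>\<alpha>. c \<alpha> * monom_at z \<alpha>)) UNIV"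
proof -
  have "(\<lambda>\<alpha>. norm (c \<alpha> * monom_at z \<alpha>)) summable_on UNIV"
    using assms(1) unfolding summable_at_def
    by (rule summable_on_comparison_test)
       (auto simp: norm_mult intro!: mult_left_mono norm_monom_at_le assms(2))
  then show ?thesis
    by (rule has_sum_infsum[OF abs_summable_summable])
qed

lemma summable_at_represents:
  "summable_at s c \<Longrightarrow> represents c (\<lambda>z. \<Sum>\<^sub>\<infinity>\<alpha>. c \<alpha> * monom_at z \<alpha>)"
  unfolding represents_def by (rule eventually_mono[OF eventually_in_polydisc summable_at_has_sum])

lemma summable_at_mono:
  assumes "summable_at s c" "\<And>\<alpha>. norm (d \<alpha>) \<le> norm (c \<alpha>)"
  shows "summable_at s d"
  using assms(1) unfolding summable_at_def
  by (rule summable_on_comparison_test) (auto intro: mult_right_mono assms(2))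

lemma summable_at_shift:
  assumes "summable_at s c"
  shows "summable_at s (\<lambda>\<beta>. c (\<beta> + \<alpha>))"
proof -
  have "(\<lambda>\<gamma>. norm (c \<gamma>) * weight s \<gamma>) summable_on range (\<lambda>\<beta>. \<beta> + \<alpha>)"
    using assms unfolding summable_at_def by (rule summable_on_subset_banach) auto
  then have "(\<lambda>\<beta>. norm (c (\<beta> + \<alpha>)) * weight s (\<beta> + \<alpha>)) summable_on UNIV"
    by (subst (asm) summable_on_reindex[OF inj_on_inverseI[of _ "\<lambda>\<gamma>. \<gamma> - \<alpha>"]]) (auto simp: o_def)
  then have "(\<lambda>\<beta>. norm (c (\<beta> + \<alpha>)) * weight s (\<beta> + \<alpha>) * (1 / weight s \<alpha>)) summable_on UNIV"
    by (rule summable_on_cmult_left)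
  then show ?thesis
    using weight_pos[of s \<alpha>] by (simp add: summable_at_def weight_add)
qed

lemma represents_unique:
  assumes "represents c g" "represents c h"
  shows "\<forall>\<^sub>F z in nhds 0. g z = h z"
  using assms unfolding represents_def by eventually_elim (rule has_sum_unique)

lemma represents_cong:
  assumes "\<forall>\<^sub>F z in nhds 0. g z = h z" "represents c g"
  shows "represents c h"
  using assms unfolding represents_def by eventually_elim simp

lemma represents_add:
  assumes "represents c g" "represents d h"
  shows "represents (\<lambda>\<alpha>. c \<alpha> + d \<alpha>) (\<lambda>z. g z + h z)"
  using assms unfolding represents_def
  by eventually_elim (simp add: distrib_right has_sum_add)

lemma represents_cmult:
  assumes "represents c g"
  shows "represents (\<lambda>\<alpha>. a * c \<alpha>) (\<lambda>z. a * g z)"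
  using assms unfolding represents_def
  by eventually_elim (simp add: mult.assoc has_sum_cmult_right)

lemma represents_monomial:
  "represents (\<lambda>\<alpha>. if \<alpha> = \<beta> then a else 0) (\<lambda>z. a * monom_at z \<beta>)"
  unfolding represents_def
  by (auto intro!: always_eventually has_sum_finite_neutralI[of "{\<beta>}"] split: if_splits)

lemma represents_at_0:
  assumes "represents c g"
  shows "c 0 = g 0"
proof -
  have "((\<lambda>\<alpha>. c \<alpha> * monom_at 0 \<alpha>) has_sum g 0) UNIV"
    using assms unfolding represents_def by (rule eventually_nhds_x_imp_x)
  moreover have "((\<lambda>\<alpha>. c \<alpha> * monom_at 0 \<alpha>) has_sum c 0) UNIV"
    by (rule has_sum_finite_neutralI[of "{0}"]) (auto simp: monom_at_def fun_eq_iff)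
  ultimately show ?thesis
    by (metis has_sum_unique)
qed

definition cauchy_prod ::
    "(('n::finite \<Rightarrow> nat) \<Rightarrow> complex) \<Rightarrow> (('n \<Rightarrow> nat) \<Rightarrow> complex) \<Rightarrow> ('n \<Rightarrow> nat) \<Rightarrow> complex" where
  "cauchy_prod c d \<gamma> = (\<Sum>\<beta> | \<beta> \<le> \<gamma>. c \<beta> * d (\<gamma> - \<beta>))"

lemma has_sum_mult_Times:
  fixes u :: "'a \<Rightarrow> complex" and v :: "'b \<Rightarrow> complex"
  assumes u: "(u has_sum x) A" and v: "(v has_sum y) B"
  shows "((\<lambda>(a, b). u a * v b) has_sum x * y) (A \<times> B)"
proof -
  let ?p = "\<lambda>(a, b). u a * v b"
  have abs: "(\<lambda>a. norm (u a)) summable_on A" "(\<lambda>b. norm (v b)) summable_on B"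
    using has_sum_imp_summable[OF u] has_sum_imp_summable[OF v]
    by (simp_all only: summable_on_iff_abs_summable_on_complex)
  have "?p summable_on A \<times> B"
  proof (rule abs_summable_summable, rule summable_on_SigmaI)
    show "((\<lambda>b. norm (?p (a, b))) has_sum norm (u a) * (\<Sum>\<^sub>\<infinity>b\<in>B. norm (v b))) B" for a
      using has_sum_cmult_right[OF has_sum_infsum[OF abs(2)], of "norm (u a)"]
      by (simp only: prod.case norm_mult)
    show "(\<lambda>a. norm (u a) * (\<Sum>\<^sub>\<infinity>b\<in>B. norm (v b))) summable_on A"
      by (rule summable_on_cmult_left[OF abs(1)])
  qed (rule norm_ge_zero)
  then show ?thesis
  proof (rule has_sum_SigmaI[rotated 2])
    show "((\<lambda>b. ?p (a, b)) has_sum u a * y) B" for a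
      unfolding prod.case by (rule has_sum_cmult_right[OF v])
    show "((\<lambda>a. u a * y) has_sum x * y) A"
      by (rule has_sum_cmult_left[OF u])
  qed
qed

lemma represents_mult:
  fixes c d :: "('n::finite \<Rightarrow> nat) \<Rightarrow> complex"
  assumes "represents c g" "represents d h"
  shows "represents (cauchy_prod c d) (\<lambda>z. g z * h z)"
  using assms unfolding represents_def
proof eventually_elim
  case (elim z)
  have "((\<lambda>(\<alpha>, \<beta>). c \<alpha> * monom_at z \<alpha> * (d \<beta> * monom_at z \<beta>)) has_sum g z * h z) (UNIV \<times> UNIV)"
    by (rule has_sum_mult_Times[OF elim])
  also have "?this \<longleftrightarrow> ((\<lambda>(\<gamma>, \<beta>). c \<beta> * d (\<gamma> - \<beta>) * monom_at z \<gamma>) has_sum g z * h z)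
      (Sigma UNIV (\<lambda>\<gamma>. {\<beta>. \<beta> \<le> \<gamma>}))"
    by (rule has_sum_reindex_bij_witness[of _ "\<lambda>(\<gamma>, \<beta>). (\<beta>, \<gamma> - \<beta>)" "\<lambda>(\<alpha>, \<beta>). (\<alpha> + \<beta>, \<alpha>)"])
       (auto simp: monom_at_add)
  finally show ?case
  proof (rule has_sum_SigmaD)
    fix \<gamma>
    show "((\<lambda>\<beta>. case (\<gamma>, \<beta>) of (\<gamma>, \<beta>) \<Rightarrow> c \<beta> * d (\<gamma> - \<beta>) * monom_at z \<gamma>) has_sum
        cauchy_prod c d \<gamma> * monom_at z \<gamma>) {\<beta>. \<beta> \<le> \<gamma>}"
      by (rule has_sum_finiteI)
         (simp_all add: finite_exponents_le cauchy_prod_def sum_distrib_right)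
  qed
qed

section \<open>Partial derivatives of power series\<close>

definition deriv_coeff :: "'n::finite \<Rightarrow> (('n \<Rightarrow> nat) \<Rightarrow> complex) \<Rightarrow> ('n \<Rightarrow> nat) \<Rightarrow> complex" where
  "deriv_coeff i c \<alpha> = of_nat (\<alpha> i + 1) * c (\<alpha> + unit_exponent i)"

lemma has_sum_deriv_coeff_iff:
  "((\<lambda>\<alpha>. deriv_coeff i c \<alpha> * monom_at z \<alpha>) has_sum x) UNIV \<longleftrightarrow>
   ((\<lambda>\<alpha>. c \<alpha> * (of_nat (\<alpha> i) * monom_at z (\<alpha> - unit_exponent i))) has_sum x) UNIV"
proof -
  have "((\<lambda>\<alpha>. deriv_coeff i c \<alpha> * monom_at z \<alpha>) has_sum x) UNIV \<longleftrightarrow>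
      ((\<lambda>\<alpha>. c \<alpha> * (of_nat (\<alpha> i) * monom_at z (\<alpha> - unit_exponent i))) has_sum x) {\<alpha>. 0 < \<alpha> i}"
    by (rule has_sum_reindex_bij_witness[of _ "\<lambda>\<alpha>. \<alpha> - unit_exponent i" "\<lambda>\<alpha>. \<alpha> + unit_exponent i"])
       (auto simp: unit_exponent_le_iff deriv_coeff_def, auto simp: unit_exponent_def)
  also have "\<dots> \<longleftrightarrow> ((\<lambda>\<alpha>. c \<alpha> * (of_nat (\<alpha> i) * monom_at z (\<alpha> - unit_exponent i))) has_sum x) UNIV"
    by (rule has_sum_cong_neutral) auto
  finally show ?thesis .
qed

text \<open>A uniform limit of holomorphic functions may be differentiated term by term, along any filter;
  along finite sets of exponents this gives the derivative of an unordered sum.\<close>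

lemma summable_at_has_field_derivative:
  assumes c: "summable_at s c" and z: "z \<in> polydisc s"
  obtains D where
    "((\<lambda>t. \<Sum>\<^sub>\<infinity>\<alpha>. c \<alpha> * monom_at (z + t *s axis i 1) \<alpha>) has_field_derivative D) (at 0)"
    "((\<lambda>\<alpha>. deriv_coeff i c \<alpha> * monom_at z \<alpha>) has_sum D) UNIV"
proof -
  let ?line = "\<lambda>t. z + t *s axis i 1"
  define partial_sum where "partial_sum X t = (\<Sum>\<alpha>\<in>X. c \<alpha> * monom_at (?line t) \<alpha>)" for X t
  define deriv_sum where
    "deriv_sum X t =
      (\<Sum>\<alpha>\<in>X. c \<alpha> * (of_nat (\<alpha> i) * monom_at (?line t) (\<alpha> - unit_exponent i)))" for X t
  have "isCont ?line t" for t
    unfolding isCont_def by (intro vec_tendstoI) (auto simp: axis_def intro!: tendsto_eq_intros)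
  then have "open (?line -` polydisc s)"
    by (intro open_vimage open_polydisc) (simp add: continuous_on_eq_continuous_at)
  moreover have "0 \<in> ?line -` polydisc s"
    using z by simp
  ultimately obtain r where r: "0 < r" "cball 0 r \<subseteq> ?line -` polydisc s"
    by (meson open_contains_cball)
  have lim: "uniform_limit (cball 0 r) partial_sum
      (\<lambda>t. \<Sum>\<^sub>\<infinity>\<alpha>. c \<alpha> * monom_at (?line t) \<alpha>) (finite_subsets_at_top UNIV)"
    unfolding partial_sum_def
  proof (rule Weierstrass_m_test_general)
    show "norm (c \<alpha> * monom_at (?line t) \<alpha>) \<le> norm (c \<alpha>) * weight s \<alpha>" if "t \<in> cball 0 r" for \<alpha> t
      using r(2) that by (auto simp: norm_mult intro!: mult_left_mono norm_monom_at_le)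
  qed (use c in \<open>simp add: summable_at_def\<close>)
  have deriv: "(partial_sum X has_field_derivative deriv_sum X t) (at t)" for X t
    unfolding partial_sum_def deriv_sum_def
    by (intro DERIV_sum DERIV_cmult monom_at_line_has_field_derivative)
  have "\<forall>\<^sub>F X in finite_subsets_at_top UNIV. continuous_on (cball 0 r) (partial_sum X) \<and>
      (\<forall>t\<in>ball 0 r. (partial_sum X has_field_derivative deriv_sum X t) (at t))"
    by (intro always_eventually allI conjI ballI continuous_at_imp_continuous_on deriv
        DERIV_isCont[OF deriv])
  from has_complex_derivative_uniform_limit[OF this lim finite_subsets_at_top_neq_bot r(1)]
  obtain D where "\<And>t. t \<in> ball 0 r \<Longrightarrow>
      ((\<lambda>t. \<Sum>\<^sub>\<infinity>\<alpha>. c \<alpha> * monom_at (?line t) \<alpha>) has_field_derivative D t) (at t) \<and>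
      ((\<lambda>X. deriv_sum X t) \<longlongrightarrow> D t) (finite_subsets_at_top UNIV)"
    by blast
  with r(1) have "((\<lambda>t. \<Sum>\<^sub>\<infinity>\<alpha>. c \<alpha> * monom_at (?line t) \<alpha>) has_field_derivative D 0) (at 0)"
      "((\<lambda>X. deriv_sum X 0) \<longlongrightarrow> D 0) (finite_subsets_at_top UNIV)"
    by auto
  then show thesis
    by (intro that) (simp_all add: deriv_sum_def has_sum_def[symmetric] has_sum_deriv_coeff_iff)
qed

lemma
  fixes c :: "('n::finite \<Rightarrow> nat) \<Rightarrow> complex"
  assumes "represents c g"
  shows represents_pd: "represents (deriv_coeff i c) (pd i g)"
    and represents_has_field_derivative:
      "\<forall>\<^sub>F z in nhds 0. ((\<lambda>t. g (z + t *s axis i 1)) has_field_derivative pd i g z) (at 0)"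
proof -
  obtain s where s: "summable_at s c"
    using represents_eventually_summable_at[OF assms] by (meson eventually_sequentially order_refl)
  have "\<forall>\<^sub>F z in nhds 0. g z = (\<Sum>\<^sub>\<infinity>\<alpha>. c \<alpha> * monom_at z \<alpha>)"
    using assms by (rule represents_unique[OF _ summable_at_represents[OF s]])
  then have "\<forall>\<^sub>F z in nhds 0. \<forall>\<^sub>F y in nhds z. g y = (\<Sum>\<^sub>\<infinity>\<alpha>. c \<alpha> * monom_at y \<alpha>)"
    by (simp add: eventually_eventually)
  then have termwise: "\<forall>\<^sub>F z in nhds 0.
      ((\<lambda>t. g (z + t *s axis i 1)) has_field_derivative pd i g z) (at 0) \<and>
      ((\<lambda>\<alpha>. deriv_coeff i c \<alpha> * monom_at z \<alpha>) has_sum pd i g z) UNIV"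
    using eventually_in_polydisc[of s]
  proof eventually_elim
    case (elim z)
    obtain D where D:
      "((\<lambda>t. \<Sum>\<^sub>\<infinity>\<alpha>. c \<alpha> * monom_at (z + t *s axis i 1) \<alpha>) has_field_derivative D) (at 0)"
      "((\<lambda>\<alpha>. deriv_coeff i c \<alpha> * monom_at z \<alpha>) has_sum D) UNIV"
      by (rule summable_at_has_field_derivative[OF s elim(2)])
    have "\<forall>\<^sub>F t in nhds 0. g (z + t *s axis i 1) = (\<Sum>\<^sub>\<infinity>\<alpha>. c \<alpha> * monom_at (z + t *s axis i 1) \<alpha>)"
      using tendsto_line elim(1) by (rule eventually_compose_filterlim[rotated])
    then have "((\<lambda>t. g (z + t *s axis i 1)) has_field_derivative D) (at 0)"
      using D(1) by (subst DERIV_cong_ev[OF refl _ refl])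
    with D(2) show ?case
      by (simp add: pd_def DERIV_imp_deriv)
  qed
  then show "represents (deriv_coeff i c) (pd i g)"
    unfolding represents_def by eventually_elim simp
  from termwise show
    "\<forall>\<^sub>F z in nhds 0. ((\<lambda>t. g (z + t *s axis i 1)) has_field_derivative pd i g z) (at 0)"
    by eventually_elim simp
qed

section \<open>Division with remainder\<close>

lemma ex_increasing_pair:
  fixes x :: "nat \<Rightarrow> 'n::finite \<Rightarrow> nat"
  shows "\<exists>i j. i < j \<and> x i \<le> x j"
proof (rule ccontr)
  assume "\<not> ?thesis"
  then have drop: "\<exists>k. x j k < x i k" if "i < j" for i j
    using that by (auto simp: le_fun_def not_le)
  obtain h :: "nat \<Rightarrow> 'n" where h: "bij_betw h {0..<CARD('n)} UNIV"
    using ex_bij_betw_nat_finite[of "UNIV :: 'n set"] by auto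
  let ?r = "{(j, i). i < (j :: nat)}" and ?T = "\<lambda>m. inv_image less_than (\<lambda>i. x i (h m))"
  have "?r \<subseteq> (\<Union>m<CARD('n). ?T m)"
  proof clarify
    fix i j :: nat
    assume "i < j"
    then obtain k where k: "x j k < x i k"
      using drop by blast
    obtain m where "m < CARD('n)" "k = h m"
      using h by (force simp: bij_betw_def)
    with k show "(j, i) \<in> (\<Union>m<CARD('n). ?T m)"
      by auto
  qed
  then have "disj_wf ?r"
    unfolding disj_wf by (intro exI[of _ ?T] exI[of _ "CARD('n)"]) auto
  then have "wf ?r"
    by (rule trans_disj_wf_implies_wf[rotated]) (auto simp: trans_def)
  then show False
    unfolding wf_iff_no_infinite_down_chain by (auto dest: spec[of _ id])
qed

lemma dickson:
  fixes E :: "('n::finite \<Rightarrow> nat) set"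
  obtains F where "F \<subseteq> E" "finite F" "\<And>\<delta>. \<delta> \<in> E \<Longrightarrow> \<exists>\<alpha>\<in>F. \<alpha> \<le> \<delta>"
proof
  let ?F = "{\<alpha>\<in>E. \<forall>\<beta>\<in>E. \<beta> \<le> \<alpha> \<longrightarrow> \<beta> = \<alpha>}"
  show "?F \<subseteq> E" by blast
  show "finite ?F"
  proof (rule ccontr)
    assume "infinite ?F"
    then obtain x :: "nat \<Rightarrow> 'n \<Rightarrow> nat" where x: "inj x" "range x \<subseteq> ?F"
      by (auto dest: infinite_countable_subset)
    obtain i j where "i < j" "x i \<le> x j"
      using ex_increasing_pair by blast
    with x(2) have "x i = x j"
      by blast
    with x(1) \<open>i < j\<close> show False
      by (simp add: inj_eq)
  qed
  fix \<delta> assume "\<delta> \<in> E"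
  then obtain \<alpha> where \<alpha>: "\<alpha> \<in> E" "\<alpha> \<le> \<delta>" "\<And>\<beta>. \<beta> \<in> E \<and> \<beta> \<le> \<delta> \<Longrightarrow> total_degree \<alpha> \<le> total_degree \<beta>"
    using ex_has_least_nat[of "\<lambda>\<alpha>. \<alpha> \<in> E \<and> \<alpha> \<le> \<delta>" \<delta> total_degree] by auto
  have "\<beta> = \<alpha>" if "\<beta> \<in> E" "\<beta> \<le> \<alpha>" for \<beta>
  proof -
    have "total_degree \<alpha> \<le> total_degree \<beta>"
      using \<alpha> that order_trans by blast
    moreover have "total_degree \<alpha> = total_degree \<beta> + total_degree (\<alpha> - \<beta>)"
      using that(2) by (simp flip: total_degree_add)
    ultimately have "\<alpha> - \<beta> = 0"
      using total_degree_eq_0_iff[of "\<alpha> - \<beta>"] by linarith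
    then show ?thesis
      using exponent_add_diff[OF that(2)] by simp
  qed
  with \<alpha> show "\<exists>\<alpha>\<in>?F. \<alpha> \<le> \<delta>" by blast
qed

context
  fixes N :: "'a \<Rightarrow> nat" and G :: "'a \<Rightarrow> 'a \<Rightarrow> 'b::real_normed_field"
  assumes fin: "\<And>K. finite {a. N a \<le> K}" and diag: "\<And>a. G a a = 1"
begin

lemma ex_unitriangular_solution:
  assumes "inj N"
  shows "\<exists>v. \<forall>\<gamma>. c \<gamma> = (\<Sum>\<delta> | N \<delta> \<le> N \<gamma>. v \<delta> * G \<delta> \<gamma>)"
proof -
  have "\<exists>v. \<forall>\<gamma>. v \<gamma> = c \<gamma> - (\<Sum>\<delta> | N \<delta> < N \<gamma>. v \<delta> * G \<delta> \<gamma>)"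
  proof (rule dependent_wf_choice[of "Wellfounded.measure N"
        "\<lambda>v \<gamma> x. x = c \<gamma> - (\<Sum>\<delta> | N \<delta> < N \<gamma>. v \<delta> * G \<delta> \<gamma>)"])
    fix v v' :: "'a \<Rightarrow> 'b" and \<gamma> x
    assume "\<And>\<delta>. (\<delta>, \<gamma>) \<in> Wellfounded.measure N \<Longrightarrow> v \<delta> = v' \<delta>"
    then have "(\<Sum>\<delta> | N \<delta> < N \<gamma>. v \<delta> * G \<delta> \<gamma>) = (\<Sum>\<delta> | N \<delta> < N \<gamma>. v' \<delta> * G \<delta> \<gamma>)"
      by (intro sum.cong) auto
    then show "(x = c \<gamma> - (\<Sum>\<delta> | N \<delta> < N \<gamma>. v \<delta> * G \<delta> \<gamma>)) =
        (x = c \<gamma> - (\<Sum>\<delta> | N \<delta> < N \<gamma>. v' \<delta> * G \<delta> \<gamma>))"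
      by simp
  qed auto
  then obtain v where v: "\<And>\<gamma>. v \<gamma> = c \<gamma> - (\<Sum>\<delta> | N \<delta> < N \<gamma>. v \<delta> * G \<delta> \<gamma>)"
    by blast
  have "c \<gamma> = (\<Sum>\<delta> | N \<delta> \<le> N \<gamma>. v \<delta> * G \<delta> \<gamma>)" for \<gamma>
  proof -
    have "{\<delta>. N \<delta> \<le> N \<gamma>} = insert \<gamma> {\<delta>. N \<delta> < N \<gamma>}"
      using injD[OF assms] by (auto simp: le_less)
    moreover have "finite {\<delta>. N \<delta> < N \<gamma>}"
      by (rule finite_subset[OF _ fin[of "N \<gamma>"]]) auto
    ultimately show ?thesis
      using v[of \<gamma>] by (simp add: diag)
  qed
  then show ?thesis
    by blast
qed

context
  fixes w :: "'a \<Rightarrow> real" and c v :: "'a \<Rightarrow> 'b"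
  assumes w: "\<And>a. 0 \<le> w a"
    and tail: "\<And>\<delta> X. finite X \<Longrightarrow> \<delta> \<notin> X \<Longrightarrow> (\<Sum>\<gamma>\<in>X. norm (G \<delta> \<gamma>) * w \<gamma>) \<le> w \<delta> / 2"
    and v: "\<And>\<gamma>. c \<gamma> = (\<Sum>\<delta> | N \<delta> \<le> N \<gamma>. v \<delta> * G \<delta> \<gamma>)"
begin

lemma unitriangular_solution_partial_sum_le:
  "(\<Sum>\<gamma> | N \<gamma> \<le> K. norm (v \<gamma>) * w \<gamma>) \<le> 2 * (\<Sum>\<gamma> | N \<gamma> \<le> K. norm (c \<gamma>) * w \<gamma>)"
proof -
  let ?S = "{\<gamma>. N \<gamma> \<le> K}"
  have "(\<Sum>\<gamma>\<in>?S. norm (v \<gamma>) * w \<gamma>)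
      \<le> (\<Sum>\<gamma>\<in>?S. norm (c \<gamma>) * w \<gamma> + (\<Sum>\<delta>\<in>{\<delta>\<in>?S. \<delta> \<noteq> \<gamma>}. norm (v \<delta>) * (norm (G \<delta> \<gamma>) * w \<gamma>)))"
  proof (rule sum_mono)
    fix \<gamma> assume \<gamma>: "\<gamma> \<in> ?S"
    have "v \<gamma> = c \<gamma> - (\<Sum>\<delta>\<in>{\<delta>. N \<delta> \<le> N \<gamma>} - {\<gamma>}. v \<delta> * G \<delta> \<gamma>)"
      unfolding v[of \<gamma>] using sum.remove[OF fin, of \<gamma> "N \<gamma>" "\<lambda>\<delta>. v \<delta> * G \<delta> \<gamma>"] by (simp add: diag)
    then have "norm (v \<gamma>) \<le> norm (c \<gamma>) + norm (\<Sum>\<delta>\<in>{\<delta>. N \<delta> \<le> N \<gamma>} - {\<gamma>}. v \<delta> * G \<delta> \<gamma>)"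
      by (simp only: norm_triangle_ineq4)
    also have "\<dots> \<le> norm (c \<gamma>) + (\<Sum>\<delta>\<in>{\<delta>. N \<delta> \<le> N \<gamma>} - {\<gamma>}. norm (v \<delta> * G \<delta> \<gamma>))"
      by (intro add_left_mono norm_sum)
    also have "(\<Sum>\<delta>\<in>{\<delta>. N \<delta> \<le> N \<gamma>} - {\<gamma>}. norm (v \<delta> * G \<delta> \<gamma>))
        \<le> (\<Sum>\<delta>\<in>{\<delta>\<in>?S. \<delta> \<noteq> \<gamma>}. norm (v \<delta> * G \<delta> \<gamma>))"
      using \<gamma> fin by (intro sum_mono2) auto
    finally have "norm (v \<gamma>) * w \<gamma> \<le> (norm (c \<gamma>) + (\<Sum>\<delta>\<in>{\<delta>\<in>?S. \<delta> \<noteq> \<gamma>}. norm (v \<delta> * G \<delta> \<gamma>))) * w \<gamma>"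
      using w by (simp add: mult_right_mono)
    then show "norm (v \<gamma>) * w \<gamma>
        \<le> norm (c \<gamma>) * w \<gamma> + (\<Sum>\<delta>\<in>{\<delta>\<in>?S. \<delta> \<noteq> \<gamma>}. norm (v \<delta>) * (norm (G \<delta> \<gamma>) * w \<gamma>))"
      by (simp only: distrib_right sum_distrib_right norm_mult mult.assoc)
  qed
  also have "\<dots> = (\<Sum>\<gamma>\<in>?S. norm (c \<gamma>) * w \<gamma>)
      + (\<Sum>\<delta>\<in>?S. norm (v \<delta>) * (\<Sum>\<gamma>\<in>{\<gamma>\<in>?S. \<delta> \<noteq> \<gamma>}. norm (G \<delta> \<gamma>) * w \<gamma>))"
    unfolding sum.distrib sum_distrib_left using fin by (subst sum.swap_restrict) auto
  also have "\<dots> \<le> (\<Sum>\<gamma>\<in>?S. norm (c \<gamma>) * w \<gamma>) + (\<Sum>\<delta>\<in>?S. norm (v \<delta>) * (w \<delta> / 2))"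
    using fin by (intro add_left_mono sum_mono mult_left_mono tail) auto
  also have "(\<Sum>\<delta>\<in>?S. norm (v \<delta>) * (w \<delta> / 2)) = (\<Sum>\<delta>\<in>?S. norm (v \<delta>) * w \<delta>) / 2"
    by (simp add: sum_divide_distrib)
  finally show ?thesis
    by simp
qed

lemma unitriangular_solution_summable:
  assumes c: "(\<lambda>\<gamma>. norm (c \<gamma>) * w \<gamma>) summable_on UNIV"
  shows "(\<lambda>\<gamma>. norm (v \<gamma>) * w \<gamma>) summable_on UNIV"
proof (rule nonneg_bdd_above_summable_on)
  show "bdd_above (sum (\<lambda>\<gamma>. norm (v \<gamma>) * w \<gamma>) ` {F. F \<subseteq> UNIV \<and> finite F})"
  proof (rule bdd_aboveI2)
    fix F :: "'a set" assume F: "F \<in> {F. F \<subseteq> UNIV \<and> finite F}"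
    define K where "K = (\<Sum>a\<in>F. N a)"
    have "(\<Sum>\<gamma>\<in>F. norm (v \<gamma>) * w \<gamma>) \<le> (\<Sum>\<gamma> | N \<gamma> \<le> K. norm (v \<gamma>) * w \<gamma>)"
      using F w fin by (intro sum_mono2) (auto simp: K_def intro: member_le_sum)
    also have "\<dots> \<le> 2 * (\<Sum>\<gamma> | N \<gamma> \<le> K. norm (c \<gamma>) * w \<gamma>)"
      by (rule unitriangular_solution_partial_sum_le)
    also have "\<dots> \<le> 2 * (\<Sum>\<^sub>\<infinity>\<gamma>. norm (c \<gamma>) * w \<gamma>)"
      using c w fin by (intro mult_left_mono finite_sum_le_infsum) auto
    finally show "(\<Sum>\<gamma>\<in>F. norm (v \<gamma>) * w \<gamma>) \<le> 2 * (\<Sum>\<^sub>\<infinity>\<gamma>. norm (c \<gamma>) * w \<gamma>)" .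
  qed
qed (use w in auto)

end

end

definition leads :: "(('n::finite \<Rightarrow> nat) \<Rightarrow> complex) \<Rightarrow> ('n \<Rightarrow> nat) \<Rightarrow> bool" where
  "leads c \<alpha> \<longleftrightarrow> c \<alpha> = 1 \<and> (\<forall>\<beta>. prime_code \<beta> < prime_code \<alpha> \<longrightarrow> c \<beta> = 0)"

definition small_tail :: "nat \<Rightarrow> (('n::finite \<Rightarrow> nat) \<Rightarrow> complex) \<Rightarrow> ('n \<Rightarrow> nat) \<Rightarrow> bool" where
  "small_tail s c \<alpha> \<longleftrightarrow>
     (\<forall>X. finite X \<longrightarrow> \<alpha> \<notin> X \<longrightarrow> (\<Sum>\<beta>\<in>X. norm (c \<beta>) * weight s \<beta>) \<le> weight s \<alpha> / 2)"

lemma leading_family_expansion: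
  fixes G :: "('n::finite \<Rightarrow> nat) \<Rightarrow> ('n \<Rightarrow> nat) \<Rightarrow> complex"
  assumes "\<And>\<delta>. leads (G \<delta>) \<delta>" "\<And>\<delta>. small_tail s (G \<delta>) \<delta>" "summable_at s c"
  obtains v where "summable_at s v"
    "\<And>\<gamma>. c \<gamma> = (\<Sum>\<delta> | prime_code \<delta> \<le> prime_code \<gamma>. v \<delta> * G \<delta> \<gamma>)"
proof -
  have diag: "G \<delta> \<delta> = 1" for \<delta>
    using assms(1) by (simp add: leads_def)
  obtain v where v: "\<And>\<gamma>. c \<gamma> = (\<Sum>\<delta> | prime_code \<delta> \<le> prime_code \<gamma>. v \<delta> * G \<delta> \<gamma>)"
    using ex_unitriangular_solution[where G = G and c = c,
        OF finite_prime_code_le diag inj_prime_code] by blast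
  moreover have "summable_at s v"
    using assms(2,3) unfolding summable_at_def small_tail_def
    by (intro unitriangular_solution_summable[OF finite_prime_code_le diag weight_nonneg _ v])
       blast+
  ultimately show thesis
    by (intro that)
qed

lemma weight_le_geometric:
  assumes "prime_code \<alpha> < prime_code \<beta>"
  shows "weight (s + k) \<beta> \<le> weight s \<beta> * (1 / (real (prime_code \<alpha>) + 1)) ^ k"
proof -
  have "(1 / real (prime_code \<beta>)) ^ k \<le> (1 / (real (prime_code \<alpha>) + 1)) ^ k"
    using assms by (intro power_mono divide_left_mono) auto
  then show ?thesis
    by (simp add: weight_eq_prime_code power_add mult_left_mono)
qed

lemma sum_tail_le_geometric:
  assumes c: "summable_at s c" "leads c \<alpha>" and X: "finite X" "\<alpha> \<notin> X"
  shows "(\<Sum>\<beta>\<in>X. norm (c \<beta>) * weight (s + k) \<beta>)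
    \<le> (\<Sum>\<^sub>\<infinity>\<beta>. norm (c \<beta>) * weight s \<beta>) * (1 / (real (prime_code \<alpha>) + 1)) ^ k"
proof -
  have "norm (c \<beta>) * weight (s + k) \<beta>
      \<le> norm (c \<beta>) * weight s \<beta> * (1 / (real (prime_code \<alpha>) + 1)) ^ k"
    if "\<beta> \<in> X" for \<beta>
  proof (cases "c \<beta> = 0")
    case False
    then have "prime_code \<alpha> \<noteq> prime_code \<beta>" "\<not> prime_code \<beta> < prime_code \<alpha>"
      using c(2) X(2) that injD[OF inj_prime_code] by (auto simp: leads_def)
    then show ?thesis
      unfolding mult.assoc by (intro mult_left_mono weight_le_geometric) auto
  qed simp
  then have "(\<Sum>\<beta>\<in>X. norm (c \<beta>) * weight (s + k) \<beta>)
      \<le> (\<Sum>\<beta>\<in>X. norm (c \<beta>) * weight s \<beta>) * (1 / (real (prime_code \<alpha>) + 1)) ^ k"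
    unfolding sum_distrib_right by (rule sum_mono)
  also have "\<dots> \<le> (\<Sum>\<^sub>\<infinity>\<beta>. norm (c \<beta>) * weight s \<beta>) * (1 / (real (prime_code \<alpha>) + 1)) ^ k"
    using c(1) X by (intro mult_right_mono finite_sum_le_infsum) (auto simp: summable_at_def)
  finally show ?thesis .
qed

lemma eventually_small_tail:
  fixes c :: "('n::finite \<Rightarrow> nat) \<Rightarrow> complex"
  assumes "summable_at s\<^sub>0 c" "leads c \<alpha>"
  shows "\<forall>\<^sub>F s in sequentially. small_tail s c \<alpha>"
proof -
  define C where "C = (\<Sum>\<^sub>\<infinity>\<beta>. norm (c \<beta>) * weight s\<^sub>0 \<beta>)"
  define A where "A = real (prime_code \<alpha>)"
  have A: "0 < A"
    by (simp add: A_def prime_code_pos)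
  have "(\<lambda>k. C * (A / (A + 1)) ^ k) \<longlonglongrightarrow> C * 0"
    using A by (intro tendsto_intros LIMSEQ_power_zero) auto
  then have "\<forall>\<^sub>F k in sequentially. C * (A / (A + 1)) ^ k < weight s\<^sub>0 \<alpha> / 2"
    by (rule order_tendstoD) (simp add: weight_pos)
  then have "\<forall>\<^sub>F k in sequentially. small_tail (s\<^sub>0 + k) c \<alpha>"
  proof eventually_elim
    case (elim k)
    have "C * (1 / (A + 1)) ^ k = C * (A / (A + 1)) ^ k * (1 / A) ^ k"
      using A by (simp add: power_divide)
    also have "\<dots> \<le> weight s\<^sub>0 \<alpha> / 2 * (1 / A) ^ k"
      using elim A by (intro mult_right_mono) auto
    also have "\<dots> = weight (s\<^sub>0 + k) \<alpha> / 2"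
      by (simp add: weight_eq_prime_code power_add A_def)
    finally show ?case
      using sum_tail_le_geometric[OF assms, of _ k] order_trans
      unfolding small_tail_def C_def A_def by blast
  qed
  then show ?thesis
    using eventually_sequentially_seg[of "\<lambda>s. small_tail s c \<alpha>" s\<^sub>0] by (simp add: add.commute)
qed

definition translate :: "('n::finite \<Rightarrow> nat) \<Rightarrow> (('n \<Rightarrow> nat) \<Rightarrow> complex) \<Rightarrow> ('n \<Rightarrow> nat) \<Rightarrow> complex" where
  "translate \<eta> c \<gamma> = (if \<eta> \<le> \<gamma> then c (\<gamma> - \<eta>) else 0)"

lemma leads_translate:
  assumes "leads c \<alpha>"
  shows "leads (translate \<eta> c) (\<eta> + \<alpha>)"
  unfolding leads_def
proof (intro conjI allI impI)
  fix \<beta> :: "'a \<Rightarrow> nat"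
  assume less: "prime_code \<beta> < prime_code (\<eta> + \<alpha>)"
  show "translate \<eta> c \<beta> = 0"
  proof (cases "\<eta> \<le> \<beta>")
    case True
    then have "prime_code \<beta> = prime_code \<eta> * prime_code (\<beta> - \<eta>)"
      by (simp flip: prime_code_add)
    with less have "prime_code (\<beta> - \<eta>) < prime_code \<alpha>"
      by (simp add: prime_code_add)
    with assms show ?thesis
      by (simp add: leads_def translate_def)
  qed (simp add: translate_def)
qed (use assms in \<open>simp add: leads_def translate_def\<close>)

lemma small_tail_translate:
  assumes "small_tail s c \<alpha>"
  shows "small_tail s (translate \<eta> c) (\<eta> + \<alpha>)"
  unfolding small_tail_def
proof (intro allI impI)
  fix X assume X: "finite X" "\<eta> + \<alpha> \<notin> X"
  define Y where "Y = (\<lambda>\<gamma>. \<gamma> - \<eta>) ` {\<gamma>\<in>X. \<eta> \<le> \<gamma>}"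
  have Y: "finite Y" "\<alpha> \<notin> Y"
    using X by (auto simp: Y_def)
  have "(\<Sum>\<gamma>\<in>X. norm (translate \<eta> c \<gamma>) * weight s \<gamma>) =
      (\<Sum>\<gamma>\<in>{\<gamma>\<in>X. \<eta> \<le> \<gamma>}. norm (c (\<gamma> - \<eta>)) * (weight s \<eta> * weight s (\<gamma> - \<eta>)))"
    using X(1)
    by (intro sum.mono_neutral_cong_right) (auto simp: translate_def simp flip: weight_add)
  also have "\<dots> = weight s \<eta> * (\<Sum>\<beta>\<in>Y. norm (c \<beta>) * weight s \<beta>)"
    unfolding Y_def sum_distrib_left
    by (subst sum.reindex[OF inj_on_inverseI[of _ "\<lambda>\<gamma>. \<gamma> + \<eta>"]]) (auto simp: mult_ac)
  also have "\<dots> \<le> weight s \<eta> * (weight s \<alpha> / 2)"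
    using assms Y by (intro mult_left_mono) (auto simp: small_tail_def)
  finally show "(\<Sum>\<gamma>\<in>X. norm (translate \<eta> c \<gamma>) * weight s \<gamma>) \<le> weight s (\<eta> + \<alpha>) / 2"
    by (simp add: weight_add)
qed

lemma cauchy_prod_eq_sum_translate:
  assumes "leads g \<alpha>"
  shows "cauchy_prod q g \<gamma> =
    (\<Sum>\<delta> | \<alpha> \<le> \<delta> \<and> prime_code \<delta> \<le> prime_code \<gamma>. q (\<delta> - \<alpha>) * translate (\<delta> - \<alpha>) g \<gamma>)"
proof -
  let ?term = "\<lambda>\<beta>. q \<beta> * translate \<beta> g \<gamma>"
  have "cauchy_prod q g \<gamma> = sum ?term {\<beta>. \<beta> \<le> \<gamma>}"
    by (simp add: cauchy_prod_def translate_def)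
  also have "\<dots> = sum ?term {\<beta>. prime_code (\<beta> + \<alpha>) \<le> prime_code \<gamma>}"
  proof (rule sum.mono_neutral_cong)
    have "{\<beta>. prime_code (\<beta> + \<alpha>) \<le> prime_code \<gamma>} \<subseteq> {\<beta>. prime_code \<beta> \<le> prime_code \<gamma>}"
      using prime_code_pos[of \<alpha>] by (auto simp: prime_code_add intro: order_trans[rotated])
    then show "finite {\<beta>. prime_code (\<beta> + \<alpha>) \<le> prime_code \<gamma>}"
      by (rule finite_subset[OF _ finite_prime_code_le])
    have "translate \<beta> g \<gamma> = 0" if "\<not> prime_code (\<beta> + \<alpha>) \<le> prime_code \<gamma>" for \<beta>
      using leads_translate[OF assms, of \<beta>] that by (simp add: leads_def)
    then show "?term \<beta> = 0" if "\<beta> \<in> {\<beta>. \<beta> \<le> \<gamma>} - {\<beta>. prime_code (\<beta> + \<alpha>) \<le> prime_code \<gamma>}" for \<beta>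
      using that by auto
  qed (auto simp: translate_def finite_exponents_le)
  also have "\<dots> = (\<Sum>\<delta> | \<alpha> \<le> \<delta> \<and> prime_code \<delta> \<le> prime_code \<gamma>. ?term (\<delta> - \<alpha>))"
    by (rule sum.reindex_bij_witness[of _ "\<lambda>\<delta>. \<delta> - \<alpha>" "\<lambda>\<beta>. \<beta> + \<alpha>"]) auto
  finally show ?thesis .
qed

definition reducer ::
    "('n::finite \<Rightarrow> nat) set \<Rightarrow> (('n \<Rightarrow> nat) \<Rightarrow> ('n \<Rightarrow> nat)) \<Rightarrow>
     (('n \<Rightarrow> nat) \<Rightarrow> ('n \<Rightarrow> nat) \<Rightarrow> complex) \<Rightarrow> ('n \<Rightarrow> nat) \<Rightarrow> ('n \<Rightarrow> nat) \<Rightarrow> complex" where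
  "reducer E lead g \<delta> = (if \<delta> \<in> E then translate (\<delta> - lead \<delta>) (g (lead \<delta>))
     else (\<lambda>\<gamma>. if \<gamma> = \<delta> then 1 else 0))"

definition quotient_coeff ::
    "('n \<Rightarrow> nat) set \<Rightarrow> (('n \<Rightarrow> nat) \<Rightarrow> ('n \<Rightarrow> nat)) \<Rightarrow>
     (('n \<Rightarrow> nat) \<Rightarrow> complex) \<Rightarrow> ('n \<Rightarrow> nat) \<Rightarrow> ('n \<Rightarrow> nat) \<Rightarrow> complex" where
  "quotient_coeff E lead v \<alpha> \<beta> = (if \<beta> + \<alpha> \<in> E \<and> lead (\<beta> + \<alpha>) = \<alpha> then v (\<beta> + \<alpha>) else 0)"

context
  fixes F E :: "('n::finite \<Rightarrow> nat) set" and lead :: "('n \<Rightarrow> nat) \<Rightarrow> ('n \<Rightarrow> nat)"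
    and g :: "('n \<Rightarrow> nat) \<Rightarrow> ('n \<Rightarrow> nat) \<Rightarrow> complex"
  assumes finite_F: "finite F" and lead: "\<And>\<delta>. \<delta> \<in> E \<Longrightarrow> lead \<delta> \<in> F \<and> lead \<delta> \<le> \<delta>"
    and leads_g: "\<And>\<alpha>. \<alpha> \<in> F \<Longrightarrow> leads (g \<alpha>) \<alpha>"
begin

lemma leads_reducer: "leads (reducer E lead g \<delta>) \<delta>"
  using leads_translate[OF leads_g, of "lead \<delta>" "\<delta> - lead \<delta>"] lead
  by (auto simp: reducer_def leads_def)

lemma small_tail_reducer:
  assumes "\<And>\<alpha>. \<alpha> \<in> F \<Longrightarrow> small_tail s (g \<alpha>) \<alpha>"
  shows "small_tail s (reducer E lead g \<delta>) \<delta>"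
  using small_tail_translate[OF assms, of "lead \<delta>" "\<delta> - lead \<delta>"] lead
  by (auto simp: reducer_def small_tail_def if_distrib if_distribR cong: if_cong)

lemma sum_translates_eq_sum_cauchy_prod:
  "(\<Sum>\<delta> | prime_code \<delta> \<le> prime_code \<gamma> \<and> \<delta> \<in> E. v \<delta> * translate (\<delta> - lead \<delta>) (g (lead \<delta>)) \<gamma>) =
   (\<Sum>\<alpha>\<in>F. cauchy_prod (quotient_coeff E lead v \<alpha>) (g \<alpha>) \<gamma>)"
proof -
  define S where "S = {\<delta>. prime_code \<delta> \<le> prime_code \<gamma> \<and> \<delta> \<in> E}"
  let ?h = "\<lambda>\<delta>. v \<delta> * translate (\<delta> - lead \<delta>) (g (lead \<delta>)) \<gamma>"
  have S: "finite S"
    unfolding S_def by (rule finite_subset[OF _ finite_prime_code_le]) auto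
  have "sum ?h {\<delta>\<in>S. lead \<delta> = \<alpha>} = cauchy_prod (quotient_coeff E lead v \<alpha>) (g \<alpha>) \<gamma>" if "\<alpha> \<in> F" for \<alpha>
    unfolding cauchy_prod_eq_sum_translate[OF leads_g[OF that]]
  proof (rule sum.mono_neutral_cong_left)
    show "finite {\<delta>. \<alpha> \<le> \<delta> \<and> prime_code \<delta> \<le> prime_code \<gamma>}"
      by (rule finite_subset[OF _ finite_prime_code_le]) auto
  qed (use lead in \<open>auto simp: S_def quotient_coeff_def\<close>)
  then have "(\<Sum>\<alpha>\<in>F. sum ?h {\<delta>\<in>S. lead \<delta> = \<alpha>}) =
      (\<Sum>\<alpha>\<in>F. cauchy_prod (quotient_coeff E lead v \<alpha>) (g \<alpha>) \<gamma>)"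
    by (rule sum.cong[OF refl])
  moreover have "(\<Sum>\<alpha>\<in>F. sum ?h {\<delta>\<in>S. lead \<delta> = \<alpha>}) = sum ?h S"
    using lead finite_F S by (intro sum.group) (auto simp: S_def)
  ultimately show ?thesis
    by (simp add: S_def)
qed

lemma sum_reducers:
  "(\<Sum>\<delta> | prime_code \<delta> \<le> prime_code \<gamma>. v \<delta> * reducer E lead g \<delta> \<gamma>) =
   (if \<gamma> \<in> E then 0 else v \<gamma>) + (\<Sum>\<alpha>\<in>F. cauchy_prod (quotient_coeff E lead v \<alpha>) (g \<alpha>) \<gamma>)"
proof -
  define S where "S = {\<delta> :: 'n \<Rightarrow> nat. prime_code \<delta> \<le> prime_code \<gamma>}"
  have S: "finite S" "\<gamma> \<in> S"
    by (simp_all add: S_def finite_prime_code_le)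
  let ?h = "\<lambda>\<delta>. v \<delta> * translate (\<delta> - lead \<delta>) (g (lead \<delta>)) \<gamma>"
  have split: "v \<delta> * reducer E lead g \<delta> \<gamma> =
      (if \<gamma> = \<delta> then if \<delta> \<in> E then 0 else v \<delta> else 0) + (if \<delta> \<in> E then ?h \<delta> else 0)" for \<delta>
    by (simp add: reducer_def)
  have "(\<Sum>\<delta>\<in>S. v \<delta> * reducer E lead g \<delta> \<gamma>) =
      (if \<gamma> \<in> E then 0 else v \<gamma>) + (\<Sum>\<delta> | \<delta> \<in> S \<and> \<delta> \<in> E. ?h \<delta>)"
    unfolding split sum.distrib sum.inter_filter[OF S(1)] using S by simp
  then show ?thesis
    unfolding S_def mem_Collect_eq sum_translates_eq_sum_cauchy_prod .
qed

end

theorem division_with_remainder: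
  fixes c :: "('n::finite \<Rightarrow> nat) \<Rightarrow> complex"
  assumes F: "finite F" "\<And>\<delta>. \<delta> \<in> E \<Longrightarrow> \<exists>\<alpha>\<in>F. \<alpha> \<le> \<delta>"
    and leads: "\<And>\<alpha>. \<alpha> \<in> F \<Longrightarrow> leads (g \<alpha>) \<alpha>"
    and tail: "\<And>\<alpha>. \<alpha> \<in> F \<Longrightarrow> small_tail s (g \<alpha>) \<alpha>"
    and c: "summable_at s c"
  obtains q r where "\<And>\<alpha>. summable_at s (q \<alpha>)" "summable_at s r" "\<And>\<delta>. \<delta> \<in> E \<Longrightarrow> r \<delta> = 0"
    "\<And>\<gamma>. c \<gamma> = r \<gamma> + (\<Sum>\<alpha>\<in>F. cauchy_prod (q \<alpha>) (g \<alpha>) \<gamma>)"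
proof -
  obtain lead where lead: "\<And>\<delta>. \<delta> \<in> E \<Longrightarrow> lead \<delta> \<in> F \<and> lead \<delta> \<le> \<delta>"
    using F(2) by metis
  note reducers = leads_reducer[OF F(1) lead leads] small_tail_reducer[OF F(1) lead leads tail]
  obtain v where v: "summable_at s v"
      "\<And>\<gamma>. c \<gamma> = (\<Sum>\<delta> | prime_code \<delta> \<le> prime_code \<gamma>. v \<delta> * reducer E lead g \<delta> \<gamma>)"
    using leading_family_expansion[where G = "reducer E lead g", OF reducers c] by metis
  show thesis
  proof (rule that)
    show "summable_at s (quotient_coeff E lead v \<alpha>)" for \<alpha>
      by (rule summable_at_mono[OF summable_at_shift[OF v(1), of \<alpha>]]) (simp add: quotient_coeff_def)
    show "summable_at s (\<lambda>\<gamma>. if \<gamma> \<in> E then 0 else v \<gamma>)"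
      by (rule summable_at_mono[OF v(1)]) simp
    show "c \<gamma> = (if \<gamma> \<in> E then 0 else v \<gamma>) +
        (\<Sum>\<alpha>\<in>F. cauchy_prod (quotient_coeff E lead v \<alpha>) (g \<alpha>) \<gamma>)" for \<gamma>
      unfolding v(2)[of \<gamma>] by (rule sum_reducers[OF F(1) lead leads])
  qed simp
qed

section \<open>The ring of germs\<close>

lemma cps_const: "cps (\<lambda>_. a)"
  using represents_monomial[of 0 a] by (auto simp: cps_iff_represents)

lemma cps_coord: "cps (\<lambda>z. z $ i)"
  using represents_monomial[of "unit_exponent i" 1] by (auto simp: cps_iff_represents)

lemma cps_add: "cps g \<Longrightarrow> cps h \<Longrightarrow> cps (\<lambda>z. g z + h z)"
  using represents_add by (fastforce simp: cps_iff_represents)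

lemma cps_mult: "cps g \<Longrightarrow> cps h \<Longrightarrow> cps (\<lambda>z. g z * h z)"
  using represents_mult by (fastforce simp: cps_iff_represents)

lemma cps_cmult: "cps g \<Longrightarrow> cps (\<lambda>z. a * g z)"
  by (intro cps_mult cps_const)

lemma cps_uminus: "cps g \<Longrightarrow> cps (\<lambda>z. - g z)"
  using cps_cmult[of g "-1"] by simp

lemma cps_diff: "cps g \<Longrightarrow> cps h \<Longrightarrow> cps (\<lambda>z. g z - h z)"
  using cps_add[of g "\<lambda>z. - h z"] cps_uminus[of h] by simp

lemma cps_sum: "(\<And>x. x \<in> A \<Longrightarrow> cps (g x)) \<Longrightarrow> cps (\<lambda>z. \<Sum>x\<in>A. g x z)"
  using cps_add cps_const[of 0] by (induction A rule: infinite_finite_induct) auto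

lemma cps_pd: "cps g \<Longrightarrow> cps (pd i g)"
  using represents_pd by (fastforce simp: cps_iff_represents)

lemma cps_has_field_derivative:
  "cps g \<Longrightarrow> \<forall>\<^sub>F z in nhds 0. ((\<lambda>t. g (z + t *s axis i 1)) has_field_derivative pd i g z) (at 0)"
  using represents_has_field_derivative by (fastforce simp: cps_iff_represents)

lemma pd_cong:
  fixes g h :: "complex^'n::finite \<Rightarrow> complex"
  assumes "\<forall>\<^sub>F z in nhds 0. g z = h z"
  shows "\<forall>\<^sub>F z in nhds 0. pd i g z = pd i h z"
proof -
  from assms have "\<forall>\<^sub>F z in nhds 0. \<forall>\<^sub>F y in nhds z. g y = h y"
    by (simp add: eventually_eventually)
  then show ?thesis
  proof eventually_elim
    case (elim z)
    have "\<forall>\<^sub>F t in nhds 0. g (z + t *s axis i 1) = h (z + t *s axis i 1)"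
      using tendsto_line elim by (rule eventually_compose_filterlim[rotated])
    then show ?case
      unfolding pd_def by (intro deriv_cong_ev) auto
  qed
qed

lemma pd_add:
  assumes "cps g" "cps h"
  shows "\<forall>\<^sub>F z in nhds 0. pd i (\<lambda>z. g z + h z) z = pd i g z + pd i h z"
  using cps_has_field_derivative[OF assms(1), of i] cps_has_field_derivative[OF assms(2), of i]
proof eventually_elim
  case (elim z)
  then show ?case
    unfolding pd_def[of i "\<lambda>z. g z + h z"] by (intro DERIV_imp_deriv DERIV_add)
qed

lemma pd_mult:
  fixes g h :: "complex^'n::finite \<Rightarrow> complex"
  assumes "cps g" "cps h"
  shows "\<forall>\<^sub>F z in nhds 0. pd i (\<lambda>z. g z * h z) z = g z * pd i h z + h z * pd i g z"
  using cps_has_field_derivative[OF assms(1), of i] cps_has_field_derivative[OF assms(2), of i]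
proof eventually_elim
  case (elim z)
  then have "((\<lambda>t. g (z + t *s axis i 1) * h (z + t *s axis i 1)) has_field_derivative
      (g z * pd i h z + h z * pd i g z)) (at 0)"
    by (auto intro!: derivative_eq_intros)
  then show ?case
    unfolding pd_def[of i "\<lambda>z. g z * h z"] by (rule DERIV_imp_deriv)
qed

lemma pd_const: "pd i (\<lambda>_. a) z = 0"
  by (simp add: pd_def)

lemma pd_coord: "pd i (\<lambda>z. z $ j) z = (if i = j then 1 else 0)"
  unfolding pd_def by (rule DERIV_imp_deriv) (auto simp: axis_def intro!: derivative_eq_intros)

lemma pd_commute:
  assumes "cps g"
  shows "\<forall>\<^sub>F z in nhds 0. pd i (pd j g) z = pd j (pd i g) z"
proof -
  obtain c where c: "represents c g"
    using assms by (auto simp: cps_iff_represents)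
  have "deriv_coeff i (deriv_coeff j c) = deriv_coeff j (deriv_coeff i c)"
    by (auto simp: deriv_coeff_def fun_eq_iff unit_exponent_def add_ac mult_ac)
  then show ?thesis
    using represents_unique represents_pd[OF represents_pd[OF c]] by metis
qed

quotient_type (overloaded) 'n germ = "complex^'n::finite \<Rightarrow> complex" / partial:
  "\<lambda>g h. cps g \<and> cps h \<and> (\<forall>\<^sub>F z in nhds 0. g z = h z)"
  morphisms rep_germ germ_of
proof (rule part_equivpI)
  show "\<exists>g :: complex^'n::finite \<Rightarrow> complex. cps g \<and> cps g \<and> (\<forall>\<^sub>F z in nhds 0. g z = g z)"
    by (intro exI[of _ "\<lambda>_. 0"]) (simp add: cps_const)
  show "symp (\<lambda>g h :: complex^'n::finite \<Rightarrow> complex. cps g \<and> cps h \<and> (\<forall>\<^sub>F z in nhds 0. g z = h z))"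
    by (auto simp: symp_def eq_commute)
  show "transp (\<lambda>g h :: complex^'n::finite \<Rightarrow> complex. cps g \<and> cps h \<and> (\<forall>\<^sub>F z in nhds 0. g z = h z))"
    unfolding transp_def by (auto elim: eventually_elim2)
qed

instantiation germ :: (finite) comm_ring_1
begin

lift_definition zero_germ :: "'a germ" is "\<lambda>_. 0" by (simp add: cps_const)
lift_definition one_germ :: "'a germ" is "\<lambda>_. 1" by (simp add: cps_const)
lift_definition plus_germ :: "'a germ \<Rightarrow> 'a germ \<Rightarrow> 'a germ" is "\<lambda>g h z. g z + h z"
  by (auto simp: cps_add elim: eventually_elim2)
lift_definition minus_germ :: "'a germ \<Rightarrow> 'a germ \<Rightarrow> 'a germ" is "\<lambda>g h z. g z - h z"
  by (auto simp: cps_diff elim: eventually_elim2)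
lift_definition uminus_germ :: "'a germ \<Rightarrow> 'a germ" is "\<lambda>g z. - g z"
  by (auto simp: cps_uminus)
lift_definition times_germ :: "'a germ \<Rightarrow> 'a germ \<Rightarrow> 'a germ" is "\<lambda>g h z. g z * h z"
  by (auto simp: cps_mult elim: eventually_elim2)

instance
proof
  show "(0 :: 'a germ) \<noteq> 1"
    by transfer (auto dest: eventually_nhds_x_imp_x)
qed (transfer; simp add: cps_add cps_mult cps_uminus cps_diff cps_const algebra_simps)+

end

instantiation germ :: (finite) real_algebra_1
begin

lift_definition scaleR_germ :: "real \<Rightarrow> 'a germ \<Rightarrow> 'a germ" is "\<lambda>r g z. of_real r * g z"
  by (auto simp: cps_cmult)

instance
  by standard (transfer; simp add: cps_add cps_mult cps_const algebra_simps)+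

end

lift_definition germ_const :: "complex \<Rightarrow> 'n::finite germ" is "\<lambda>a _. a"
  by (simp add: cps_const)

lift_definition germ_coord :: "'n::finite \<Rightarrow> 'n germ" is "\<lambda>i z. z $ i"
  by (simp add: cps_coord)

lift_definition germ_pd :: "'n::finite \<Rightarrow> 'n germ \<Rightarrow> 'n germ" is pd
  by (simp add: cps_pd pd_cong)

lift_definition germ_at_0 :: "'n::finite germ \<Rightarrow> complex" is "\<lambda>g. g 0"
  by (auto dest: eventually_nhds_x_imp_x)

lift_definition series_of :: "(('n::finite \<Rightarrow> nat) \<Rightarrow> complex) \<Rightarrow> 'n germ \<Rightarrow> bool" is represents
  by (auto intro: represents_cong simp: eq_commute)

lemma scaleR_germ_eq: "r *\<^sub>R g = germ_const (of_real r) * g"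
  by transfer (simp add: cps_cmult)

lemma germ_at_0_simps [simp]:
  "germ_at_0 0 = 0" "germ_at_0 1 = 1" "germ_at_0 (g + h) = germ_at_0 g + germ_at_0 h"
  "germ_at_0 (g - h) = germ_at_0 g - germ_at_0 h" "germ_at_0 (g * h) = germ_at_0 g * germ_at_0 h"
  "germ_at_0 (germ_const a) = a" "germ_at_0 (germ_coord i) = 0"
  "germ_at_0 (r *\<^sub>R g) = of_real r * germ_at_0 g"
  by (transfer; simp)+

lemma germ_at_0_sum [simp]: "germ_at_0 (sum g A) = (\<Sum>x\<in>A. germ_at_0 (g x))"
  by (induction A rule: infinite_finite_induct) auto

lemma germ_const_simps [simp]:
  "germ_const 0 = 0" "germ_const 1 = 1"
  "germ_const (a + b) = germ_const a + germ_const b"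
  "germ_const (a * b) = germ_const a * germ_const b"
  "germ_const (- a) = - germ_const a"
  by (transfer; simp add: cps_const)+

lemma germ_const_sum [simp]: "germ_const (sum f A) = (\<Sum>x\<in>A. germ_const (f x))"
  by (induction A rule: infinite_finite_induct) auto

lemma germ_pd_simps [simp]:
  "germ_pd i (g + h) = germ_pd i g + germ_pd i h"
  "germ_pd i (germ_const a) = 0"
  "germ_pd i (germ_coord j) = (if i = j then 1 else 0)"
  by (transfer; simp add: pd_add cps_pd cps_add pd_const pd_coord cps_const cps_coord)+

lemma germ_pd_mult: "germ_pd i (g * h) = g * germ_pd i h + h * germ_pd i g"
  by (transfer; simp add: pd_mult cps_pd cps_add cps_mult)+

lemma germ_pd_commute: "germ_pd i (germ_pd j g) = germ_pd j (germ_pd i g)"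
  by (transfer; simp add: pd_commute cps_pd)

lemma germ_pd_cmult: "germ_pd i (germ_const a * g) = germ_const a * germ_pd i g"
  by (simp add: germ_pd_mult)

lemma linear_germ_pd: "linear (germ_pd i)"
  by (rule linearI) (simp_all add: scaleR_germ_eq germ_pd_cmult)

lemmas germ_pd_diff [simp] = linear_diff[OF linear_germ_pd]
  and germ_pd_sum [simp] = linear_sum[OF linear_germ_pd]
  and germ_pd_scaleR [simp] = linear_scale[OF linear_germ_pd]

lemma ex_series_of: "\<exists>c. series_of c g"
  by transfer (simp add: cps_iff_represents)

lemma series_of_unique: "series_of c g \<Longrightarrow> series_of c h \<Longrightarrow> g = h"
  by transfer (auto intro: represents_unique)

lemma series_of_eventually_summable_at: "series_of c g \<Longrightarrow> \<forall>\<^sub>F s in sequentially. summable_at s c"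
  by transfer (auto intro: represents_eventually_summable_at)

lemma series_of_summable_at:
  assumes "series_of c g"
  obtains s where "summable_at s c"
  using eventually_happens'[OF sequentially_bot series_of_eventually_summable_at[OF assms]] by blast

lemma ex_germ_of_summable_at:
  assumes "summable_at s c"
  shows "\<exists>g. series_of c g"
proof
  show "series_of c (germ_of (\<lambda>z. \<Sum>\<^sub>\<infinity>\<alpha>. c \<alpha> * monom_at z \<alpha>))"
    using summable_at_represents[OF assms]
    by (subst series_of.abs_eq) (auto simp: eq_onp_def cps_iff_represents)
qed

lemma series_of_add: "series_of c g \<Longrightarrow> series_of d h \<Longrightarrow> series_of (\<lambda>\<alpha>. c \<alpha> + d \<alpha>) (g + h)"
  by transfer (rule represents_add)

lemma series_of_cmult: "series_of c g \<Longrightarrow> series_of (\<lambda>\<alpha>. a * c \<alpha>) (germ_const a * g)"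
  by transfer (rule represents_cmult)

lemma series_of_diff: "series_of c g \<Longrightarrow> series_of d h \<Longrightarrow> series_of (\<lambda>\<alpha>. c \<alpha> - d \<alpha>) (g - h)"
  using series_of_add[of c g "\<lambda>\<alpha>. - d \<alpha>" "- h"] series_of_cmult[of d h "-1"] by simp

lemma series_of_mult: "series_of c g \<Longrightarrow> series_of d h \<Longrightarrow> series_of (cauchy_prod c d) (g * h)"
  by transfer (rule represents_mult)

lemma series_of_zero: "series_of (\<lambda>_. 0) 0"
  by transfer (simp add: represents_def)

lemma series_of_sum:
  "(\<And>x. x \<in> A \<Longrightarrow> series_of (c x) (g x)) \<Longrightarrow> series_of (\<lambda>\<alpha>. \<Sum>x\<in>A. c x \<alpha>) (sum g A)"
proof (induction A rule: infinite_finite_induct)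
  case (insert x F)
  then show ?case
    using series_of_add[of "c x" "g x" "\<lambda>\<alpha>. \<Sum>x\<in>F. c x \<alpha>" "sum g F"] by simp
qed (simp_all add: series_of_zero)

lemma series_of_pd: "series_of c g \<Longrightarrow> series_of (deriv_coeff i c) (germ_pd i g)"
  by transfer (rule represents_pd)

lemma series_of_at_0: "series_of c g \<Longrightarrow> c 0 = germ_at_0 g"
  by transfer (rule represents_at_0)

lemma series_of_coord_mult:
  assumes "series_of d h"
  shows "series_of (translate (unit_exponent i) d) (germ_coord i * h)"
proof -
  have "series_of (\<lambda>\<alpha>. if \<alpha> = unit_exponent i then 1 else 0) (germ_coord i)"
    by transfer (use represents_monomial[of "unit_exponent _" 1] in simp)
  moreover have "cauchy_prod (\<lambda>\<alpha>. if \<alpha> = unit_exponent i then 1 else 0) d =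
      translate (unit_exponent i) d"
    by (rule ext) (simp add: cauchy_prod_def translate_def finite_exponents_le
        if_distrib[of "\<lambda>x. x * _"] cong: if_cong)
  ultimately show ?thesis
    using series_of_mult assms by metis
qed

section \<open>The order filtration\<close>

definition ord_ge :: "nat \<Rightarrow> 'n::finite germ set" where
  "ord_ge k = {g. \<exists>c. series_of c g \<and> (\<forall>\<alpha>. total_degree \<alpha> < k \<longrightarrow> c \<alpha> = 0)}"

lemma ord_geI: "series_of c g \<Longrightarrow> (\<And>\<alpha>. total_degree \<alpha> < k \<Longrightarrow> c \<alpha> = 0) \<Longrightarrow> g \<in> ord_ge k"
  by (auto simp: ord_ge_def)

lemma ord_geE:
  assumes "g \<in> ord_ge k"
  obtains c where "series_of c g" "\<And>\<alpha>. total_degree \<alpha> < k \<Longrightarrow> c \<alpha> = 0"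
  using assms by (auto simp: ord_ge_def)

lemma ord_ge_0 [simp]: "g \<in> ord_ge 0"
  using ex_series_of by (auto simp: ord_ge_def)

lemma ord_ge_antimono: "k \<le> l \<Longrightarrow> ord_ge l \<subseteq> ord_ge k"
  by (fastforce simp: ord_ge_def)

lemma ord_ge_mult:
  assumes "g \<in> ord_ge k" "h \<in> ord_ge l"
  shows "g * h \<in> ord_ge (k + l)"
proof -
  obtain c d where c: "series_of c g" "\<And>\<alpha>. total_degree \<alpha> < k \<Longrightarrow> c \<alpha> = 0"
      and d: "series_of d h" "\<And>\<alpha>. total_degree \<alpha> < l \<Longrightarrow> d \<alpha> = 0"
    using assms by (auto elim!: ord_geE)
  show ?thesis
  proof (rule ord_geI[OF series_of_mult[OF c(1) d(1)]])
    fix \<gamma> :: "'a \<Rightarrow> nat" assume \<gamma>: "total_degree \<gamma> < k + l"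
    have "c \<beta> * d (\<gamma> - \<beta>) = 0" if "\<beta> \<le> \<gamma>" for \<beta>
    proof -
      have "total_degree \<beta> + total_degree (\<gamma> - \<beta>) = total_degree \<gamma>"
        using that by (simp flip: total_degree_add)
      with \<gamma> have "total_degree \<beta> < k \<or> total_degree (\<gamma> - \<beta>) < l"
        by linarith
      then show ?thesis
        using c(2) d(2) by auto
    qed
    then show "cauchy_prod c d \<gamma> = 0"
      by (auto simp: cauchy_prod_def intro!: sum.neutral)
  qed
qed

lemma ord_ge_pd: "g \<in> ord_ge (Suc k) \<Longrightarrow> germ_pd i g \<in> ord_ge k"
  by (elim ord_geE, rule ord_geI[OF series_of_pd]) (auto simp: deriv_coeff_def total_degree_add)

lemma ord_ge_1_iff: "g \<in> ord_ge 1 \<longleftrightarrow> germ_at_0 g = 0"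
proof -
  obtain c where c: "series_of c g"
    using ex_series_of by blast
  then show ?thesis
    using series_of_at_0 by (fastforce simp: ord_ge_def)
qed

lemma germ_coord_ord_ge: "germ_coord i \<in> ord_ge 1"
  by (simp only: ord_ge_1_iff germ_at_0_simps)

lemma coefficient_coordinate_decomposition:
  fixes c :: "('n::finite \<Rightarrow> nat) \<Rightarrow> complex"
  assumes "c 0 = 0"
  obtains b where "\<And>i \<beta>. b i \<beta> \<in> {0, c (\<beta> + unit_exponent i)}"
    "\<And>\<gamma>. c \<gamma> = (\<Sum>i\<in>UNIV. translate (unit_exponent i) (b i) \<gamma>)"
proof -
  have "\<exists>j. \<alpha> \<noteq> 0 \<longrightarrow> 0 < \<alpha> j" for \<alpha> :: "'n \<Rightarrow> nat"
    by (auto simp: fun_eq_iff)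
  then obtain idx where idx: "\<And>\<alpha> :: 'n \<Rightarrow> nat. \<alpha> \<noteq> 0 \<Longrightarrow> 0 < \<alpha> (idx \<alpha>)"
    by metis
  define b where
    "b i \<beta> = (if idx (\<beta> + unit_exponent i) = i then c (\<beta> + unit_exponent i) else 0)" for i \<beta>
  show thesis
  proof (rule that)
    show "b i \<beta> \<in> {0, c (\<beta> + unit_exponent i)}" for i \<beta>
      by (simp add: b_def)
    have "translate (unit_exponent i) (b i) \<gamma> = (if i = idx \<gamma> then c \<gamma> else 0)" for i \<gamma>
    proof (cases "\<gamma> = 0")
      case True
      have "\<not> unit_exponent i \<le> (0 :: 'n \<Rightarrow> nat)"
        by (subst unit_exponent_le_iff) simp
      then show ?thesis
        using assms by (simp add: True translate_def)
    next
      case False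
      then show ?thesis
        using idx[OF False] by (auto simp: translate_def b_def unit_exponent_le_iff)
    qed
    then show "c \<gamma> = (\<Sum>i\<in>UNIV. translate (unit_exponent i) (b i) \<gamma>)" for \<gamma>
      by simp
  qed
qed

lemma ord_ge_Suc_decomposition:
  fixes g :: "'n::finite germ"
  assumes "g \<in> ord_ge (Suc k)"
  obtains b where "\<And>i. b i \<in> ord_ge k" "g = (\<Sum>i\<in>UNIV. germ_coord i * b i)"
proof -
  obtain c where c: "series_of c g" "\<And>\<alpha>. total_degree \<alpha> < Suc k \<Longrightarrow> c \<alpha> = 0"
    using assms by (auto elim: ord_geE)
  obtain s where s: "summable_at s c"
    by (rule series_of_summable_at[OF c(1)])
  have "c 0 = 0"
    using c(2)[of 0] by (simp add: total_degree_eq_0_iff[THEN iffD2])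
  from coefficient_coordinate_decomposition[where c = c, OF this]
  obtain b where b: "\<And>i \<beta>. b i \<beta> \<in> {0, c (\<beta> + unit_exponent i)}"
      "\<And>\<gamma>. c \<gamma> = (\<Sum>i\<in>UNIV. translate (unit_exponent i) (b i) \<gamma>)"
    by blast
  have "norm (b i \<beta>) \<le> norm (c (\<beta> + unit_exponent i))" for i \<beta>
    using b(1)[of i \<beta>] by auto
  then have "summable_at s (b i)" for i
    by (rule summable_at_mono[OF summable_at_shift[OF s]])
  then have "\<exists>h. series_of (b i) h" for i
    by (rule ex_germ_of_summable_at)
  then obtain h where h: "\<And>i. series_of (b i) (h i)"
    by metis
  show thesis
  proof (rule that)
    show "h i \<in> ord_ge k" for i
      using b(1)[of i] c(2)[of "_ + unit_exponent i"]
      by (intro ord_geI[OF h]) (force simp: total_degree_add)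
    have "series_of c (\<Sum>i\<in>UNIV. germ_coord i * h i)"
      unfolding b(2)[abs_def] by (intro series_of_sum series_of_coord_mult h)
    then show "g = (\<Sum>i\<in>UNIV. germ_coord i * h i)"
      by (rule series_of_unique[OF c(1)])
  qed
qed

global_interpretation ideal: module "(*) :: 'a::comm_ring_1 \<Rightarrow> 'a \<Rightarrow> 'a"
  by unfold_locales (simp_all add: algebra_simps)

(* scale_scale would undo mult.assoc *)
declare ideal.scale_scale [simp del]

lemma ideal_scaleR: "g \<in> ideal.span S \<Longrightarrow> r *\<^sub>R (g :: 'n::finite germ) \<in> ideal.span S"
  unfolding scaleR_germ_eq by (rule ideal.span_scale)

lemma subspace_ord_ge: "ideal.subspace (ord_ge k)"
proof (rule ideal.subspaceI)
  show "0 \<in> ord_ge k"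
    by (rule ord_geI[OF series_of_zero]) simp
  show "g + h \<in> ord_ge k" if "g \<in> ord_ge k" "h \<in> ord_ge k" for g h :: "'a germ"
    using that by (elim ord_geE) (rule ord_geI, erule (1) series_of_add, simp)
  show "a * g \<in> ord_ge k" if "g \<in> ord_ge k" for a g :: "'a germ"
    using ord_ge_mult[of a 0 g k] that by simp
qed

lemmas ord_ge_add = ideal.subspace_add[OF subspace_ord_ge]
  and ord_ge_diff = ideal.subspace_diff[OF subspace_ord_ge]
  and ord_ge_sum = ideal.subspace_sum[OF subspace_ord_ge]
  and ord_ge_mult_left = ideal.subspace_scale[OF subspace_ord_ge]

lemma ord_ge_scaleR: "g \<in> ord_ge k \<Longrightarrow> r *\<^sub>R g \<in> ord_ge k"
  unfolding scaleR_germ_eq by (rule ord_ge_mult_left)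

lemma in_ideal_plus_ord_ge_iff:
  "f \<in> ideal.span (S \<union> ord_ge k) \<longleftrightarrow> (\<exists>h\<in>ideal.span S. f - h \<in> ord_ge k)"
proof -
  have "ideal.span (ord_ge k) = (ord_ge k :: 'a germ set)"
    by (subst ideal.span_eq_iff) (rule subspace_ord_ge)
  then have "f \<in> ideal.span (S \<union> ord_ge k) \<longleftrightarrow> (\<exists>h g. f = h + g \<and> h \<in> ideal.span S \<and> g \<in> ord_ge k)"
    by (simp only: ideal.span_Un mem_Collect_eq)
  also have "\<dots> \<longleftrightarrow> (\<exists>h\<in>ideal.span S. f - h \<in> ord_ge k)"
    by (metis add_diff_cancel_left' diff_add_cancel add.commute)
  finally show ?thesis .
qed

lemma ord_ge_1_mult_ideal_plus_ord_ge:
  assumes "a \<in> ord_ge 1" "x \<in> ideal.span (S \<union> ord_ge k)"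
  shows "a * x \<in> ideal.span (S \<union> ord_ge (Suc k))"
proof -
  obtain h where h: "h \<in> ideal.span S" "x - h \<in> ord_ge k"
    using assms(2) by (auto simp: in_ideal_plus_ord_ge_iff)
  have "a * x - a * h \<in> ord_ge (1 + k)"
    unfolding right_diff_distrib[symmetric] by (rule ord_ge_mult[OF assms(1) h(2)])
  then show ?thesis
    using ideal.span_scale[OF h(1)] by (auto simp: in_ideal_plus_ord_ge_iff)
qed

section \<open>Krull's intersection theorem and Nakayama's lemma\<close>

definition leading_exponents :: "'n::finite germ set \<Rightarrow> ('n \<Rightarrow> nat) set" where
  "leading_exponents I = {\<alpha>. \<exists>c h. series_of c h \<and> h \<in> I \<and> leads c \<alpha>}"

lemma ex_standard_basis:
  fixes S :: "'n::finite germ set"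
  obtains F g h where "finite F"
    "\<And>\<delta>. \<delta> \<in> leading_exponents (ideal.span S) \<Longrightarrow> \<exists>\<alpha>\<in>F. \<alpha> \<le> \<delta>"
    "\<And>\<alpha>. \<alpha> \<in> F \<Longrightarrow> h \<alpha> \<in> ideal.span S" "\<And>\<alpha>. \<alpha> \<in> F \<Longrightarrow> series_of (g \<alpha>) (h \<alpha>)"
    "\<And>\<alpha>. \<alpha> \<in> F \<Longrightarrow> leads (g \<alpha>) \<alpha>" "\<forall>\<^sub>F s in sequentially. \<forall>\<alpha>\<in>F. small_tail s (g \<alpha>) \<alpha>"
proof -
  obtain F where F: "F \<subseteq> leading_exponents (ideal.span S)" "finite F"
      "\<And>\<delta>. \<delta> \<in> leading_exponents (ideal.span S) \<Longrightarrow> \<exists>\<alpha>\<in>F. \<alpha> \<le> \<delta>"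
    by (rule dickson[of "leading_exponents (ideal.span S)"]) blast
  then have "\<forall>\<alpha>\<in>F. \<exists>c h. series_of c h \<and> h \<in> ideal.span S \<and> leads c \<alpha>"
    by (auto simp: leading_exponents_def)
  then obtain g h where basis: "\<And>\<alpha>. \<alpha> \<in> F \<Longrightarrow> h \<alpha> \<in> ideal.span S"
      "\<And>\<alpha>. \<alpha> \<in> F \<Longrightarrow> series_of (g \<alpha>) (h \<alpha>)" "\<And>\<alpha>. \<alpha> \<in> F \<Longrightarrow> leads (g \<alpha>) \<alpha>"
    by metis
  have "\<forall>\<^sub>F s in sequentially. \<forall>\<alpha>\<in>F. small_tail s (g \<alpha>) \<alpha>"
  proof (intro eventually_ball_finite ballI F(2))
    fix \<alpha> assume "\<alpha> \<in> F"
    then obtain s where "summable_at s (g \<alpha>)"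
      using series_of_summable_at basis(2) by blast
    then show "\<forall>\<^sub>F s in sequentially. small_tail s (g \<alpha>) \<alpha>"
      using basis(3)[OF \<open>\<alpha> \<in> F\<close>] by (rule eventually_small_tail)
  qed
  with F(2,3) basis show thesis
    by (rule that)
qed

lemma ideal_division_with_remainder:
  fixes f :: "'n::finite germ"
  obtains r R where "series_of r R" "f - R \<in> ideal.span S"
    "\<And>\<delta>. \<delta> \<in> leading_exponents (ideal.span S) \<Longrightarrow> r \<delta> = 0"
proof -
  obtain F g h where F: "finite F"
      "\<And>\<delta>. \<delta> \<in> leading_exponents (ideal.span S) \<Longrightarrow> \<exists>\<alpha>\<in>F. \<alpha> \<le> \<delta>"
    and basis: "\<And>\<alpha>. \<alpha> \<in> F \<Longrightarrow> h \<alpha> \<in> ideal.span S" "\<And>\<alpha>. \<alpha> \<in> F \<Longrightarrow> series_of (g \<alpha>) (h \<alpha>)"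
      "\<And>\<alpha>. \<alpha> \<in> F \<Longrightarrow> leads (g \<alpha>) \<alpha>"
    and tail: "\<forall>\<^sub>F s in sequentially. \<forall>\<alpha>\<in>F. small_tail s (g \<alpha>) \<alpha>"
    by (rule ex_standard_basis[of S]) blast
  obtain c where c: "series_of c f"
    using ex_series_of by blast
  obtain s where s: "summable_at s c" "\<And>\<alpha>. \<alpha> \<in> F \<Longrightarrow> small_tail s (g \<alpha>) \<alpha>"
    using eventually_happens'[OF sequentially_bot
        eventually_conj[OF series_of_eventually_summable_at[OF c] tail]] by blast
  obtain q r where qr: "\<And>\<alpha>. summable_at s (q \<alpha>)" "summable_at s r"
      "\<And>\<delta>. \<delta> \<in> leading_exponents (ideal.span S) \<Longrightarrow> r \<delta> = 0"
      "\<And>\<gamma>. c \<gamma> = r \<gamma> + (\<Sum>\<alpha>\<in>F. cauchy_prod (q \<alpha>) (g \<alpha>) \<gamma>)"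
    using division_with_remainder[OF F basis(3) s(2,1)] by blast
  obtain R where R: "series_of r R"
    using ex_germ_of_summable_at[OF qr(2)] by blast
  obtain Q where Q: "\<And>\<alpha>. series_of (q \<alpha>) (Q \<alpha>)"
    using ex_germ_of_summable_at[OF qr(1)] by metis
  have "series_of c (R + (\<Sum>\<alpha>\<in>F. Q \<alpha> * h \<alpha>))"
    unfolding qr(4)[abs_def] by (intro series_of_add series_of_sum series_of_mult R Q basis)
  then have "f - R = (\<Sum>\<alpha>\<in>F. Q \<alpha> * h \<alpha>)"
    using series_of_unique[OF c] by (simp add: algebra_simps)
  also have "\<dots> \<in> ideal.span S"
    by (intro ideal.span_sum ideal.span_scale basis)
  finally show thesis
    using R qr(3) that by blast
qed

lemma ex_leading_exponent_in_support:
  fixes R :: "'n::finite germ"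
  assumes R: "\<And>k. R \<in> ideal.span (S \<union> ord_ge k)" and r: "series_of r R" "r \<gamma> \<noteq> 0"
  shows "\<exists>\<rho>\<in>leading_exponents (ideal.span S). r \<rho> \<noteq> 0"
proof -
  obtain \<rho> where \<rho>: "r \<rho> \<noteq> 0" "\<And>\<beta>. r \<beta> \<noteq> 0 \<Longrightarrow> prime_code \<rho> \<le> prime_code \<beta>"
    using ex_has_least_nat[of "\<lambda>\<beta>. r \<beta> \<noteq> 0" \<gamma> prime_code] r(2) by blast
  obtain h where h: "h \<in> ideal.span S" "R - h \<in> ord_ge (prime_code \<rho>)"
    using R by (auto simp: in_ideal_plus_ord_ge_iff)
  then obtain d where d: "series_of d (R - h)" "\<And>\<alpha>. total_degree \<alpha> < prime_code \<rho> \<Longrightarrow> d \<alpha> = 0"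
    by (auto elim: ord_geE)
  let ?a = "1 / r \<rho>"
  have "d \<beta> = 0" if "prime_code \<beta> \<le> prime_code \<rho>" for \<beta>
    using d(2) total_degree_less_prime_code[of \<beta>] that by simp
  with \<rho> have "leads (\<lambda>\<beta>. ?a * (r \<beta> - d \<beta>)) \<rho>"
    by (auto simp: leads_def not_le[symmetric])
  moreover have "series_of (\<lambda>\<beta>. ?a * (r \<beta> - d \<beta>)) (germ_const ?a * (R - (R - h)))"
    by (intro series_of_cmult series_of_diff r d)
  moreover have "germ_const ?a * (R - (R - h)) \<in> ideal.span S"
    using h(1) by (intro ideal.span_scale) simp
  ultimately show ?thesis
    using \<rho>(1) unfolding leading_exponents_def by blast
qed

theorem krull_intersection:
  assumes "\<And>k. f \<in> ideal.span (S \<union> ord_ge k)"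
  shows "f \<in> ideal.span S"
proof -
  obtain r R where R: "series_of r R" "f - R \<in> ideal.span S"
      "\<And>\<delta>. \<delta> \<in> leading_exponents (ideal.span S) \<Longrightarrow> r \<delta> = 0"
    by (rule ideal_division_with_remainder[of f S]) blast
  have "f - (f - R) \<in> ideal.span (S \<union> ord_ge k)" for k
    by (intro ideal.span_diff assms subsetD[OF ideal.span_mono R(2)]) auto
  then have "R \<in> ideal.span (S \<union> ord_ge k)" for k
    by simp
  then have "r = (\<lambda>_. 0)"
    using ex_leading_exponent_in_support[OF _ R(1), of S] R(3) by fastforce
  then have "R = 0"
    using series_of_unique R(1) series_of_zero by metis
  with R(2) show ?thesis
    by simp
qed

definition coord_multiples :: "'n::finite germ set \<Rightarrow> 'n germ set" where
  "coord_multiples S = {germ_coord j * s | j s. s \<in> S}"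

lemma coord_multiples_insert:
  "coord_multiples (insert s S) = coord_multiples S \<union> coord_multiples {s}"
  by (auto simp: coord_multiples_def)

lemma ord_ge_1_mult_ideal:
  assumes "a \<in> ord_ge 1" "h \<in> ideal.span S"
  shows "a * h \<in> ideal.span (coord_multiples S)"
  using assms(2)
proof (induction rule: ideal.span_induct_alt)
  case base
  show ?case
    by (simp add: ideal.span_zero)
next
  case (step c s h)
  obtain b where b: "a = (\<Sum>i\<in>UNIV. germ_coord i * b i)"
    using ord_ge_Suc_decomposition assms(1) by (metis One_nat_def)
  have "a * (c * s) = (\<Sum>i\<in>UNIV. (b i * c) * (germ_coord i * s))"
    unfolding b sum_distrib_right by (simp add: mult_ac)
  also have "\<dots> \<in> ideal.span (coord_multiples S)"
    using step.hyps
    by (intro ideal.span_sum ideal.span_scale ideal.span_base) (auto simp: coord_multiples_def)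
  finally show ?case
    unfolding distrib_left using step.IH by (rule ideal.span_add)
qed

theorem nakayama:
  assumes "e \<in> ideal.span (T \<union> coord_multiples {e})"
  shows "e \<in> ideal.span T"
proof (rule krull_intersection)
  show "e \<in> ideal.span (T \<union> ord_ge k)" for k
  proof (induction k)
    case 0
    show ?case
      by (simp add: ideal.span_base)
  next
    case (Suc k)
    have "coord_multiples {e} \<subseteq> ideal.span (T \<union> ord_ge (Suc k))"
      using ord_ge_1_mult_ideal_plus_ord_ge[OF germ_coord_ord_ge Suc]
      by (auto simp: coord_multiples_def)
    then have "ideal.span (T \<union> coord_multiples {e}) \<subseteq> ideal.span (T \<union> ord_ge (Suc k))"
      by (intro ideal.span_minimal) (auto intro: ideal.span_base)
    with assms show ?case
      by blast
  qed
qed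

lemma one_in_ideal:
  fixes s :: "'n::finite germ"
  assumes "s \<in> ideal.span S" "germ_at_0 s \<noteq> 0"
  shows "1 \<in> ideal.span S"
proof (rule nakayama)
  define c :: "'n germ" where "c = germ_const (1 / germ_at_0 s)"
  have "1 - c * s \<in> ord_ge 1"
    unfolding ord_ge_1_iff using assms(2) by (simp add: c_def)
  from ord_ge_1_mult_ideal[OF this ideal.span_base[of 1 "{1}"]]
  have "1 - c * s \<in> ideal.span (S \<union> coord_multiples {1})"
    using ideal.span_mono[of "coord_multiples {1}" "S \<union> coord_multiples {1}"] by auto
  moreover have "c * s \<in> ideal.span (S \<union> coord_multiples {1})"
    using ideal.span_scale[OF assms(1)] ideal.span_mono[of S "S \<union> coord_multiples {1}"] by blast
  ultimately have "(1 - c * s) + c * s \<in> ideal.span (S \<union> coord_multiples {1})"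
    by (rule ideal.span_add)
  then show "1 \<in> ideal.span (S \<union> coord_multiples {1})"
    by simp
qed

section \<open>Vector fields and derivations\<close>

definition vector_field :: "('n::finite \<Rightarrow> 'n germ) \<Rightarrow> 'n germ \<Rightarrow> 'n germ" where
  "vector_field a g = (\<Sum>i\<in>UNIV. a i * germ_pd i g)"

lemma linear_vector_field: "linear (vector_field a)"
  by (rule linearI) (simp_all add: vector_field_def distrib_left sum.distrib scaleR_sum_right)

lemmas vector_field_add = linear_add[OF linear_vector_field]

lemma vector_field_mult: "vector_field a (g * h) = g * vector_field a h + h * vector_field a g"
  by (simp add: vector_field_def germ_pd_mult algebra_simps sum.distrib sum_distrib_left)

lemma vector_field_const: "vector_field a (germ_const c) = 0"
  by (simp add: vector_field_def)

lemma vector_field_coord: "vector_field a (germ_coord i) = a i"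
  by (simp add: vector_field_def if_distrib[of "\<lambda>x. _ * x"] cong: if_cong)

lemma vector_field_add_coeff:
  "vector_field (\<lambda>i. a i + b i) g = vector_field a g + vector_field b g"
  by (simp add: vector_field_def distrib_right sum.distrib)

lemma germ_pd_vector_field:
  "germ_pd j (vector_field a g) =
   vector_field a (germ_pd j g) + vector_field (\<lambda>i. germ_pd j (a i)) g"
  by (simp add: vector_field_def germ_pd_mult sum.distrib germ_pd_commute[of j] mult.commute)

lemma vector_field_ord_ge:
  assumes "\<And>i. a i \<in> ord_ge 1" "g \<in> ord_ge k"
  shows "vector_field a g \<in> ord_ge k"
proof (cases k)
  case (Suc l)
  have "a i * germ_pd i g \<in> ord_ge (1 + l)" for i
    using assms Suc by (intro ord_ge_mult ord_ge_pd) auto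
  then show ?thesis
    unfolding vector_field_def Suc by (intro ord_ge_sum) auto
qed simp

lemma vector_field_in_ideal:
  assumes "\<And>i. a i \<in> ideal.span S"
  shows "vector_field a g \<in> ideal.span S"
  unfolding vector_field_def
  by (intro ideal.span_sum) (subst mult.commute, rule ideal.span_scale[OF assms])

definition derivation_mod :: "'n::finite germ set \<Rightarrow> ('n germ \<Rightarrow> 'n germ) \<Rightarrow> bool" where
  "derivation_mod I D \<longleftrightarrow>
     (\<forall>g h. D (g + h) - (D g + D h) \<in> I) \<and>
     (\<forall>c g. D (germ_const c * g) - germ_const c * D g \<in> I) \<and>
     (\<forall>g h. D (g * h) - (g * D h + h * D g) \<in> I)"

lemma derivation_modD:
  assumes "derivation_mod I D"
  shows "D (g + h) - (D g + D h) \<in> I" "D (germ_const c * g) - germ_const c * D g \<in> I"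
    "D (g * h) - (g * D h + h * D g) \<in> I"
  using assms by (auto simp: derivation_mod_def)

lemma derivation_mod_diff_vector_field:
  assumes "derivation_mod I D"
  shows "derivation_mod I (\<lambda>g. D g - vector_field a g)"
proof -
  have "D (g + h) - vector_field a (g + h) - (D g - vector_field a g + (D h - vector_field a h)) =
      D (g + h) - (D g + D h)" for g h
    by (simp add: vector_field_add)
  moreover have "D (germ_const c * g) - vector_field a (germ_const c * g)
      - germ_const c * (D g - vector_field a g) = D (germ_const c * g) - germ_const c * D g" for c g
    by (simp add: vector_field_mult vector_field_const algebra_simps)
  moreover have "D (g * h) - vector_field a (g * h)
      - (g * (D h - vector_field a h) + h * (D g - vector_field a g)) =
      D (g * h) - (g * D h + h * D g)" for g h
    by (simp add: vector_field_mult algebra_simps)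
  ultimately show ?thesis
    using derivation_modD[OF assms] by (simp only: derivation_mod_def simp_thms)
qed

lemma derivation_mod_const:
  assumes "derivation_mod (ideal.span S) D"
  shows "D (germ_const c) \<in> ideal.span S"
proof -
  have "D 1 \<in> ideal.span S"
    using ideal.span_neg[OF derivation_modD(3)[OF assms, of 1 1]] by simp
  from ideal.span_add[OF derivation_modD(2)[OF assms, of c 1]
      ideal.span_scale[OF this, of "germ_const c"]]
  show ?thesis
    by simp
qed

lemma derivation_mod_sum:
  assumes "derivation_mod (ideal.span S) D"
  shows "D (sum g A) - (\<Sum>x\<in>A. D (g x)) \<in> ideal.span S"
proof (induction A rule: infinite_finite_induct)
  case (insert x F)
  have "D (sum g (insert x F)) - (\<Sum>x\<in>insert x F. D (g x)) =
      (D (g x + sum g F) - (D (g x) + D (sum g F))) + (D (sum g F) - (\<Sum>x\<in>F. D (g x)))"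
    using insert by simp
  also have "\<dots> \<in> ideal.span S"
    by (intro ideal.span_add derivation_modD(1)[OF assms] insert.IH)
  finally show ?case .
qed (use derivation_mod_const[OF assms, of 0] in simp_all)

lemma derivation_mod_coord_expansion:
  assumes D: "derivation_mod (ideal.span S) D" and coord: "\<And>i. D (germ_coord i) \<in> ideal.span S"
    and g: "g = germ_const c + (\<Sum>i\<in>UNIV. germ_coord i * b i)"
  shows "D g - (\<Sum>i\<in>UNIV. germ_coord i * D (b i)) \<in> ideal.span S"
proof -
  let ?p = "\<Sum>i\<in>UNIV. germ_coord i * b i"
  have "D (germ_coord i * b i) - germ_coord i * D (b i) \<in> ideal.span S" for i
    using ideal.span_add[OF derivation_modD(3)[OF D, of "germ_coord i" "b i"]
        ideal.span_scale[OF coord[of i], of "b i"]] by simp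
  then have "(\<Sum>i\<in>UNIV. D (germ_coord i * b i)) - (\<Sum>i\<in>UNIV. germ_coord i * D (b i)) \<in> ideal.span S"
    unfolding sum_subtractf[symmetric] by (intro ideal.span_sum)
  from ideal.span_add[OF derivation_mod_sum[OF D, of "\<lambda>i. germ_coord i * b i" UNIV] this]
  have "D ?p - (\<Sum>i\<in>UNIV. germ_coord i * D (b i)) \<in> ideal.span S"
    by simp
  from ideal.span_add[OF ideal.span_add[OF derivation_modD(1)[OF D, of "germ_const c" ?p]
      derivation_mod_const[OF D, of c]] this]
  show ?thesis
    unfolding g by (simp add: algebra_simps)
qed

lemma derivation_mod_eq_0:
  fixes D :: "'n::finite germ \<Rightarrow> 'n germ"
  assumes D: "derivation_mod (ideal.span S) D" and coord: "\<And>i. D (germ_coord i) \<in> ideal.span S"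
  shows "D g \<in> ideal.span S"
proof (rule krull_intersection)
  show "D g \<in> ideal.span (S \<union> ord_ge k)" for k
  proof (induction k arbitrary: g)
    case 0
    show ?case
      by (simp add: ideal.span_base)
  next
    case (Suc k)
    have "g - germ_const (germ_at_0 g) \<in> ord_ge 1"
      by (simp only: ord_ge_1_iff germ_at_0_simps diff_self)
    then obtain b where "g - germ_const (germ_at_0 g) = (\<Sum>i\<in>UNIV. germ_coord i * b i)"
      using ord_ge_Suc_decomposition by (metis One_nat_def)
    then have "g = germ_const (germ_at_0 g) + (\<Sum>i\<in>UNIV. germ_coord i * b i)"
      by (simp add: algebra_simps)
    from derivation_mod_coord_expansion[OF D coord this]
    have "D g - (\<Sum>i\<in>UNIV. germ_coord i * D (b i)) \<in> ideal.span (S \<union> ord_ge (Suc k))"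
      using ideal.span_mono[of S "S \<union> ord_ge (Suc k)"] by blast
    moreover have "(\<Sum>i\<in>UNIV. germ_coord i * D (b i)) \<in> ideal.span (S \<union> ord_ge (Suc k))"
      by (intro ideal.span_sum ord_ge_1_mult_ideal_plus_ord_ge germ_coord_ord_ge Suc)
    ultimately show ?case
      using ideal.span_add by fastforce
  qed
qed

theorem derivation_mod_eq_vector_field:
  assumes "derivation_mod (ideal.span S) D"
  shows "D g - vector_field (\<lambda>i. D (germ_coord i)) g \<in> ideal.span S"
  using derivation_mod_diff_vector_field[OF assms]
  by (rule derivation_mod_eq_0) (simp add: vector_field_coord ideal.span_zero)

section \<open>Generalised eigenvectors\<close>

text \<open>The elements mapped into \<open>N\<close> by some product of operators \<open>X - l\<close> with \<open>l \<in> \<Lambda>\<close>.\<close>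

inductive_set generalized_eigen ::
    "('a::real_vector \<Rightarrow> 'a) \<Rightarrow> real set \<Rightarrow> 'a set \<Rightarrow> 'a set" for X \<Lambda> N where
  base: "g \<in> N \<Longrightarrow> g \<in> generalized_eigen X \<Lambda> N"
| step: "l \<in> \<Lambda> \<Longrightarrow> X g - l *\<^sub>R g \<in> generalized_eigen X \<Lambda> N \<Longrightarrow> g \<in> generalized_eigen X \<Lambda> N"

lemma generalized_eigen_trans:
  assumes "g \<in> generalized_eigen X \<Lambda> M" "M \<subseteq> generalized_eigen X \<Lambda> N"
  shows "g \<in> generalized_eigen X \<Lambda> N"
  using assms by induction (auto intro: generalized_eigen.step)

lemma generalized_eigen_mono:
  assumes "g \<in> generalized_eigen X \<Lambda> N" "\<Lambda> \<subseteq> \<Lambda>'" "N \<subseteq> N'"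
  shows "g \<in> generalized_eigen X \<Lambda>' N'"
  using assms by induction (auto intro: generalized_eigen.intros)

context
  fixes X :: "'a::real_vector \<Rightarrow> 'a" and N :: "'a set"
  assumes linear: "linear X" and subspace: "subspace N" and stable: "\<And>g. g \<in> N \<Longrightarrow> X g \<in> N"
begin

lemma linear_shift_add: "X (g + h) - l *\<^sub>R (g + h) = (X g - l *\<^sub>R g) + (X h - l *\<^sub>R h)"
  by (simp add: linear_add[OF linear] scaleR_add_right)

lemma generalized_eigen_shift:
  assumes "g \<in> generalized_eigen X \<Lambda> N"
  shows "X g - c *\<^sub>R g \<in> generalized_eigen X \<Lambda> N"
  using assms
proof induction
  case (base g)
  then show ?case
    by (intro generalized_eigen.base subspace_diff[OF subspace] subspace_scale[OF subspace] stable)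
next
  case (step l g)
  have "X (X g - l *\<^sub>R g) - c *\<^sub>R (X g - l *\<^sub>R g) = X (X g - c *\<^sub>R g) - l *\<^sub>R (X g - c *\<^sub>R g)"
    by (simp add: linear_diff[OF linear] linear_scale[OF linear] scaleR_diff_right mult.commute)
  with step show ?case
    by (metis generalized_eigen.step)
qed

lemma generalized_eigen_scaleR:
  assumes "g \<in> generalized_eigen X \<Lambda> N"
  shows "c *\<^sub>R g \<in> generalized_eigen X \<Lambda> N"
  using assms
proof induction
  case (base g)
  then show ?case
    by (intro generalized_eigen.base subspace_scale[OF subspace])
next
  case (step l g)
  have "c *\<^sub>R (X g - l *\<^sub>R g) = X (c *\<^sub>R g) - l *\<^sub>R (c *\<^sub>R g)"
    by (simp add: linear_scale[OF linear] scaleR_diff_right mult.commute)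
  with step show ?case
    by (metis generalized_eigen.step)
qed

lemma generalized_eigen_add:
  assumes "g \<in> generalized_eigen X \<Lambda> N" "h \<in> generalized_eigen X \<Lambda> N"
  shows "g + h \<in> generalized_eigen X \<Lambda> N"
  using assms
proof (induction arbitrary: h)
  case (base g)
  from base(2,1) show ?case
  proof (induction arbitrary: g)
    case (base h)
    then show ?case
      by (intro generalized_eigen.base subspace_add[OF subspace])
  next
    case (step l h)
    have "X g - l *\<^sub>R g \<in> N"
      by (intro subspace_diff[OF subspace] subspace_scale[OF subspace] stable step.prems)
    then have "X (g + h) - l *\<^sub>R (g + h) \<in> generalized_eigen X \<Lambda> N"
      unfolding linear_shift_add by (rule step.IH)
    with step.hyps(1) show ?case
      by (rule generalized_eigen.step)
  qed
next
  case (step l g)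
  have "X h - l *\<^sub>R h \<in> generalized_eigen X \<Lambda> N"
    by (rule generalized_eigen_shift[OF step.prems])
  then have "X (g + h) - l *\<^sub>R (g + h) \<in> generalized_eigen X \<Lambda> N"
    unfolding linear_shift_add by (rule step.IH)
  with step.hyps(1) show ?case
    by (rule generalized_eigen.step)
qed

lemma subspace_generalized_eigen: "subspace (generalized_eigen X \<Lambda> N)"
  by (intro subspaceI generalized_eigen_add generalized_eigen_scaleR)
     (auto intro: generalized_eigen.base subspace_0[OF subspace])

end

lemma subspace_generalized_eigen_vector_field:
  assumes "\<And>i. a i \<in> ord_ge 1"
  shows "subspace (generalized_eigen (vector_field a) \<Lambda> (ord_ge k))"
proof (rule subspace_generalized_eigen[OF linear_vector_field])
  show "subspace (ord_ge k)"
    by (intro subspaceI ord_ge_add ord_ge_scaleR ideal.subspace_0[OF subspace_ord_ge])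
  show "vector_field a g \<in> ord_ge k" if "g \<in> ord_ge k" for g
    by (rule vector_field_ord_ge[OF assms that])
qed

lemma generalized_eigen_mult:
  fixes u :: "'n::finite germ"
  assumes a: "\<And>i. a i \<in> ord_ge 1"
    and u: "u \<in> ord_ge 1" "vector_field a u - l *\<^sub>R u \<in> ord_ge 2" "0 < l"
    and g: "g \<in> generalized_eigen (vector_field a) {0..} (ord_ge (Suc k))" "g \<in> ord_ge k"
  shows "g * u \<in> generalized_eigen (vector_field a) {0<..} (ord_ge (k + 2))"
  using g
proof induction
  case (base g)
  then show ?case
    using ord_ge_mult[OF base(1) u(1)] by (intro generalized_eigen.base) simp
next
  case (step m g)
  let ?K = "generalized_eigen (vector_field a) {0<..} (ord_ge (k + 2))"
  have "vector_field a g - m *\<^sub>R g \<in> ord_ge k"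
    by (intro ord_ge_diff vector_field_ord_ge ord_ge_scaleR a step.prems)
  then have "(vector_field a g - m *\<^sub>R g) * u \<in> ?K"
    by (rule step.IH)
  moreover have "g * (vector_field a u - l *\<^sub>R u) \<in> ?K"
    by (intro generalized_eigen.base ord_ge_mult step.prems u(2))
  ultimately have "(vector_field a g - m *\<^sub>R g) * u + g * (vector_field a u - l *\<^sub>R u) \<in> ?K"
    by (rule subspace_add[OF subspace_generalized_eigen_vector_field[OF a]])
  also have "(vector_field a g - m *\<^sub>R g) * u + g * (vector_field a u - l *\<^sub>R u) =
      vector_field a (g * u) - (m + l) *\<^sub>R (g * u)"
    by (simp add: vector_field_mult algebra_simps)
  finally have "vector_field a (g * u) - (m + l) *\<^sub>R (g * u) \<in> ?K" .
  moreover have "m + l \<in> {0<..}"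
    using step.hyps(1) u(3) by simp
  ultimately show ?case
    by (rule generalized_eigen.step[rotated])
qed

section \<open>Local coordinates\<close>

definition grad :: "'n::finite germ \<Rightarrow> complex^'n" where
  "grad g = (\<chi> j. germ_at_0 (germ_pd j g))"

definition jacobian_at_0 :: "('n::finite \<Rightarrow> 'n germ) \<Rightarrow> complex^'n^'n" where
  "jacobian_at_0 u = (\<chi> i. grad (u i))"

definition local_coordinates :: "('n::finite \<Rightarrow> 'n germ) \<Rightarrow> bool" where
  "local_coordinates u \<longleftrightarrow> (\<forall>i. germ_at_0 (u i) = 0) \<and> invertible (jacobian_at_0 u)"

lemma local_coordinatesD:
  assumes "local_coordinates u"
  shows "germ_at_0 (u i) = 0" "invertible (jacobian_at_0 u)"
  using assms by (simp_all add: local_coordinates_def)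

lemma ord_ge_2I:
  fixes g :: "'n::finite germ"
  assumes "germ_at_0 g = 0" "grad g = 0"
  shows "g \<in> ord_ge 2"
proof -
  have "g \<in> ord_ge (Suc 0)"
    using assms(1) ord_ge_1_iff[of g] by simp
  then obtain b where b: "g = (\<Sum>i\<in>UNIV. germ_coord i * b i)"
    using ord_ge_Suc_decomposition by blast
  have "b j \<in> ord_ge 1" for j
  proof -
    have "germ_at_0 (germ_pd j g) = germ_at_0 (b j)"
      unfolding b by (simp add: germ_pd_mult if_distrib[of germ_at_0] if_distrib[of "\<lambda>x. _ * x"]
          cong: if_cong)
    moreover have "germ_at_0 (germ_pd j g) = 0"
      using assms(2) by (simp add: grad_def vec_eq_iff)
    ultimately show ?thesis
      by (simp only: ord_ge_1_iff)
  qed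
  then have "germ_coord i * b i \<in> ord_ge (1 + 1)" for i
    by (intro ord_ge_mult germ_coord_ord_ge)
  then show ?thesis
    unfolding b by (intro ord_ge_sum) (simp add: numeral_2_eq_2)
qed

lemma grad_add: "grad (g + h) = grad g + grad h"
  by (simp add: grad_def vec_eq_iff)

lemma grad_diff: "grad (g - h) = grad g - grad h"
  by (simp add: grad_def vec_eq_iff)

lemma grad_zero [simp]: "grad 0 = 0"
  using grad_diff[of 0 0] by simp

lemma grad_sum: "grad (sum g A) = (\<Sum>x\<in>A. grad (g x))"
  by (induction A rule: infinite_finite_induct) (auto simp: grad_add)

lemma grad_mult: "germ_at_0 h = 0 \<Longrightarrow> grad (g * h) = germ_at_0 g *s grad h"
  by (simp add: grad_def vec_eq_iff germ_pd_mult)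

lemma grad_coord: "grad (germ_coord i) = axis i 1"
  by (auto simp: grad_def vec_eq_iff axis_def)

lemma grad_in_span:
  assumes "g \<in> ideal.span U" "\<And>u. u \<in> U \<Longrightarrow> germ_at_0 u = 0"
  shows "grad g \<in> vec.span (grad ` U)"
  using assms(1)
  by (induction rule: ideal.span_induct_alt)
     (simp_all add: assms(2) grad_add grad_mult vec.span_zero vec.span_add vec.span_scale
       vec.span_base)

lemma ex_local_coordinates:
  fixes U :: "'n::finite germ set"
  assumes gen: "\<And>i. germ_coord i \<in> ideal.span U" and U: "\<And>u. u \<in> U \<Longrightarrow> germ_at_0 u = 0"
  obtains u where "local_coordinates u" "\<And>i. u i \<in> U"
proof -
  obtain B where B: "B \<subseteq> grad ` U" "vec.independent B" "grad ` U \<subseteq> vec.span B"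
    using vec.maximal_independent_subset by blast
  have "axis i 1 \<in> vec.span (grad ` U)" for i :: 'n
    using grad_in_span[OF gen U] by (simp add: grad_coord)
  then have "cart_basis \<subseteq> vec.span B"
    using vec.span_minimal[OF B(3) vec.subspace_span] by (auto simp: cart_basis_def)
  then have span_B: "vec.span B = UNIV"
    using vec.span_minimal[OF _ vec.subspace_span, of cart_basis B] by (auto simp: span_cart_basis)
  have "card B = CARD('n)"
    using vec.dim_eq_card_independent[OF B(2)] vec.dim_span[of B] span_B vec_dim_card by metis
  then obtain h where h: "bij_betw h (UNIV :: 'n set) B"
    using finite_same_card_bij[of "UNIV :: 'n set" B] vec.finiteI_independent[OF B(2)] by auto
  then have "h i \<in> grad ` U" for i
    using B(1) by (auto simp: bij_betw_def)
  then obtain u where u: "\<And>i. u i \<in> U" "\<And>i. grad (u i) = h i"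
    unfolding image_iff by metis
  have "rows (jacobian_at_0 u) = B"
    using h by (auto simp: rows_def row_def jacobian_at_0_def u(2) bij_betw_def)
  then have "invertible (jacobian_at_0 u)"
    using span_B by (simp add: invertible_left_inverse matrix_left_invertible_span_rows_gen)
  then have "local_coordinates u"
    using U u(1) by (simp add: local_coordinates_def)
  then show thesis
    using u(1) by (rule that)
qed

lemma germ_coord_approximation:
  assumes "\<And>i. germ_at_0 (u i) = 0" "A ** jacobian_at_0 u = mat 1"
  shows "germ_coord i - (\<Sum>j\<in>UNIV. germ_const (A $ i $ j) * u j) \<in> ord_ge 2"
proof (rule ord_ge_2I)
  have "(\<Sum>j\<in>UNIV. A $ i $ j *s grad (u j)) = (A ** jacobian_at_0 u) $ i"
    by (simp add: matrix_matrix_mult_def jacobian_at_0_def vec_eq_iff)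
  also have "\<dots> = axis i 1"
    by (auto simp: assms(2) mat_def axis_def vec_eq_iff)
  finally show "grad (germ_coord i - (\<Sum>j\<in>UNIV. germ_const (A $ i $ j) * u j)) = 0"
    by (simp add: grad_diff grad_sum grad_mult assms(1) grad_coord)
qed (simp add: assms(1))

lemma ord_ge_Suc_local_coordinates:
  fixes u :: "'n::finite \<Rightarrow> 'n germ"
  assumes "local_coordinates u" "g \<in> ord_ge (Suc k)"
  obtains b where "\<And>j. b j \<in> ord_ge k" "g - (\<Sum>j\<in>UNIV. b j * u j) \<in> ord_ge (k + 2)"
proof -
  obtain A where A: "A ** jacobian_at_0 u = mat 1"
    using assms(1) by (auto simp: local_coordinates_def invertible_def)
  let ?r = "\<lambda>i. germ_coord i - (\<Sum>j\<in>UNIV. germ_const (A $ i $ j) * u j)"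
  obtain b where b: "\<And>i. b i \<in> ord_ge k" "g = (\<Sum>i\<in>UNIV. germ_coord i * b i)"
    using ord_ge_Suc_decomposition[OF assms(2)] by blast
  define b' where "b' j = (\<Sum>i\<in>UNIV. germ_const (A $ i $ j) * b i)" for j
  have "(\<Sum>j\<in>UNIV. b' j * u j) = (\<Sum>i\<in>UNIV. b i * (\<Sum>j\<in>UNIV. germ_const (A $ i $ j) * u j))"
    unfolding b'_def sum_distrib_right sum_distrib_left by (subst sum.swap) (simp add: mult_ac)
  then have "g - (\<Sum>j\<in>UNIV. b' j * u j) = (\<Sum>i\<in>UNIV. b i * ?r i)"
    by (simp add: b(2) right_diff_distrib sum_subtractf mult.commute)
  moreover have "?r i \<in> ord_ge 2" for i
    using assms(1) by (intro germ_coord_approximation A) (simp add: local_coordinates_def)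
  then have "(\<Sum>i\<in>UNIV. b i * ?r i) \<in> ord_ge (k + 2)"
    by (intro ord_ge_sum ord_ge_mult b(1))
  moreover have "b' j \<in> ord_ge k" for j
    unfolding b'_def by (intro ord_ge_sum ord_ge_mult_left b(1))
  ultimately show thesis
    by (intro that[of b']) simp_all
qed

section \<open>Vector fields with positive diagonalisable linear part\<close>

definition positive_linear_part :: "('n::finite \<Rightarrow> 'n germ) \<Rightarrow> bool" where
  "positive_linear_part a \<longleftrightarrow> (\<exists>u l. local_coordinates u \<and>
     (\<forall>j. 0 < l j \<and> vector_field a (u j) - l j *\<^sub>R u j \<in> ord_ge 2))"

lemma germ_at_0_vector_field:
  "germ_at_0 (vector_field a (u j)) = (jacobian_at_0 u *v (\<chi> i. germ_at_0 (a i))) $ j"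
  by (simp add: vector_field_def jacobian_at_0_def grad_def matrix_vector_mult_def mult.commute)

lemma positive_linear_part_coeff:
  assumes "positive_linear_part a"
  shows "a i \<in> ord_ge 1"
proof -
  obtain u l where u: "\<And>j. germ_at_0 (u j) = 0" "invertible (jacobian_at_0 u)"
      and eigen: "\<And>j. vector_field a (u j) - l j *\<^sub>R u j \<in> ord_ge 2"
    using assms by (auto simp: positive_linear_part_def local_coordinates_def)
  obtain A where A: "A ** jacobian_at_0 u = mat 1"
    using u(2) by (auto simp: invertible_def)
  have "vector_field a (u j) - l j *\<^sub>R u j \<in> ord_ge 1" for j
    by (rule subsetD[OF ord_ge_antimono eigen]) simp
  then have "germ_at_0 (vector_field a (u j)) = 0" for j
    unfolding ord_ge_1_iff by (simp add: u(1))
  then have "jacobian_at_0 u *v (\<chi> i. germ_at_0 (a i)) = 0"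
    by (simp add: vec_eq_iff flip: germ_at_0_vector_field)
  then have "(A ** jacobian_at_0 u) *v (\<chi> i. germ_at_0 (a i)) = 0"
    by (simp flip: matrix_vector_mul_assoc)
  then show ?thesis
    by (simp only: ord_ge_1_iff) (simp add: A vec_eq_iff)
qed

lemma generalized_eigen_raise_order:
  assumes a: "positive_linear_part a"
    and lower: "\<And>b. b \<in> ord_ge k \<Longrightarrow> b \<in> generalized_eigen (vector_field a) {0..} (ord_ge (Suc k))"
    and g: "g \<in> ord_ge (Suc k)"
  shows "g \<in> generalized_eigen (vector_field a) {0<..} (ord_ge (k + 2))"
proof -
  let ?K = "generalized_eigen (vector_field a) {0<..} (ord_ge (k + 2))"
  note coeff = positive_linear_part_coeff[OF a]
  note subspace = subspace_generalized_eigen_vector_field[OF coeff]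
  obtain u l where u: "local_coordinates u" "\<And>j. 0 < l j"
      "\<And>j. vector_field a (u j) - l j *\<^sub>R u j \<in> ord_ge 2"
    using a by (auto simp: positive_linear_part_def)
  have u_ord: "u j \<in> ord_ge 1" for j
    using u(1) by (simp only: ord_ge_1_iff local_coordinates_def)
  obtain b where b: "\<And>j. b j \<in> ord_ge k" "g - (\<Sum>j\<in>UNIV. b j * u j) \<in> ord_ge (k + 2)"
    using ord_ge_Suc_local_coordinates[OF u(1) g] by blast
  have "b j * u j \<in> ?K" for j
    by (rule generalized_eigen_mult[OF coeff u_ord u(3,2) lower[OF b(1)] b(1)])
  then have "(\<Sum>j\<in>UNIV. b j * u j) \<in> ?K"
    by (intro subspace_sum[OF subspace])
  from subspace_add[OF subspace this generalized_eigen.base[OF b(2)]] show ?thesis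
    by simp
qed

lemma ord_ge_generalized_eigen_Suc:
  assumes a: "positive_linear_part a"
  shows "g \<in> ord_ge k \<Longrightarrow> g \<in> generalized_eigen (vector_field a) {0..} (ord_ge (Suc k))"
proof (induction k arbitrary: g)
  case 0
  have "vector_field a g \<in> ord_ge (1 + 0)"
    unfolding vector_field_def using positive_linear_part_coeff[OF a]
    by (intro ord_ge_sum ord_ge_mult ord_ge_0)
  then show ?case
    by (auto intro: generalized_eigen.step[of 0, OF _ generalized_eigen.base])
next
  case (Suc k)
  have "g \<in> generalized_eigen (vector_field a) {0<..} (ord_ge (k + 2))"
    by (rule generalized_eigen_raise_order[OF a Suc.IH Suc.prems])
  then show ?case
    by (auto intro: generalized_eigen_mono)
qed

theorem ord_ge_1_generalized_eigen:
  assumes a: "positive_linear_part a" and g: "g \<in> ord_ge 1"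
  shows "g \<in> generalized_eigen (vector_field a) {0<..} (ord_ge (Suc k))"
proof (induction k)
  case 0
  show ?case
    using g by (intro generalized_eigen.base) simp
next
  case (Suc k)
  have "ord_ge (Suc k) \<subseteq> generalized_eigen (vector_field a) {0<..} (ord_ge (k + 2))"
    using generalized_eigen_raise_order[OF a ord_ge_generalized_eigen_Suc[OF a]] by blast
  with Suc show ?case
    using generalized_eigen_trans by fastforce
qed

lemma generalized_eigen_in_ideal:
  fixes a :: "'n::finite \<Rightarrow> 'n germ"
  assumes a: "\<And>i. a i \<in> ord_ge 1"
    and stable: "\<And>h. h \<in> ideal.span S \<Longrightarrow> vector_field a h \<in> ideal.span S"
    and g: "g \<in> generalized_eigen (vector_field a) {0<..} (ord_ge k)"
    and pd: "\<And>j. germ_pd j g \<in> ideal.span S"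
  shows "g \<in> ideal.span (coord_multiples S \<union> ord_ge k)" (is "_ \<in> ?J")
  using g pd
proof induction
  case (base g)
  then show ?case
    by (simp add: ideal.span_base)
next
  case (step l g)
  let ?h = "vector_field a g - l *\<^sub>R g"
  have "germ_pd j ?h \<in> ideal.span S" for j
    unfolding germ_pd_diff germ_pd_vector_field germ_pd_scaleR
      vector_field_def[of "\<lambda>i. germ_pd j (a i)"]
    by (intro ideal.span_diff ideal.span_add ideal.span_sum ideal.span_scale ideal_scaleR stable
        step.prems)
  then have "?h \<in> ?J"
    by (rule step.IH)
  moreover have "vector_field a g \<in> ideal.span (coord_multiples S)"
    unfolding vector_field_def by (intro ideal.span_sum ord_ge_1_mult_ideal a step.prems)
  then have "vector_field a g \<in> ?J"
    using ideal.span_mono[of "coord_multiples S" "coord_multiples S \<union> ord_ge k"] by blast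
  ultimately have "(1 / l) *\<^sub>R (vector_field a g - ?h) \<in> ?J"
    by (rule ideal_scaleR[OF ideal.span_diff[rotated]])
  then show ?case
    using step.hyps(1) by simp
qed

theorem stable_vector_field_imp_in_coord_multiples:
  assumes "positive_linear_part a" "\<And>h. h \<in> ideal.span S \<Longrightarrow> vector_field a h \<in> ideal.span S"
    and "germ_at_0 f = 0" "\<And>j. germ_pd j f \<in> ideal.span S"
  shows "f \<in> ideal.span (coord_multiples S)"
proof (rule krull_intersection)
  fix k
  have "f \<in> ord_ge 1"
    using assms(3) by (simp only: ord_ge_1_iff)
  then have "f \<in> generalized_eigen (vector_field a) {0<..} (ord_ge (Suc k))"
    by (rule ord_ge_1_generalized_eigen[OF assms(1)])
  then have "f \<in> generalized_eigen (vector_field a) {0<..} (ord_ge k)"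
    by (rule generalized_eigen_mono) (simp_all add: ord_ge_antimono)
  from generalized_eigen_in_ideal[OF positive_linear_part_coeff[OF assms(1)] assms(2) this assms(4)]
  show "f \<in> ideal.span (coord_multiples S \<union> ord_ge k)" .
qed

lemma ex_diagonal_correction:
  fixes a :: "'n::finite \<Rightarrow> 'n germ"
  assumes J: "invertible (jacobian_at_0 u)"
    and S: "\<And>h. h \<in> ideal.span S \<Longrightarrow> germ_at_0 h = 0"
    and c: "\<And>j. vector_field a (u j) - l j *\<^sub>R u j \<in> ideal.span S"
  obtains b where "\<And>i. b i \<in> ideal.span S"
    "\<And>j. vector_field (\<lambda>i. a i + b i) (u j) - l j *\<^sub>R u j \<in> ord_ge 2"
proof -
  obtain A where A: "jacobian_at_0 u ** A = mat 1"
    using J by (auto simp: invertible_def)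
  define c where "c j = vector_field a (u j) - l j *\<^sub>R u j" for j
  define b where "b i = - (\<Sum>k\<in>UNIV. germ_const (A $ i $ k) * c k)" for i
  have b: "b i \<in> ideal.span S" for i
    unfolding b_def c_def by (intro ideal.span_neg ideal.span_sum ideal.span_scale assms)
  have "vector_field (\<lambda>i. a i + b i) (u j) - l j *\<^sub>R u j \<in> ord_ge 2" for j
  proof -
    have "(\<Sum>i\<in>UNIV. b i * germ_const (jacobian_at_0 u $ j $ i)) =
        - (\<Sum>k\<in>UNIV. germ_const ((jacobian_at_0 u ** A) $ j $ k) * c k)"
      unfolding b_def matrix_matrix_mult_def
      by (simp add: sum_distrib_left sum_distrib_right sum_negf mult_ac) (rule sum.swap)
    also have "\<dots> = - c j"
      by (simp add: A mat_def if_distrib[of germ_const] if_distrib[of "\<lambda>x. x * _"] cong: if_cong)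
    finally have "vector_field (\<lambda>i. a i + b i) (u j) - l j *\<^sub>R u j =
        (\<Sum>i\<in>UNIV. b i * (germ_pd i (u j) - germ_const (jacobian_at_0 u $ j $ i)))"
      by (simp add: vector_field_add_coeff vector_field_def[of b] right_diff_distrib
          sum_subtractf c_def)
    also have "\<dots> \<in> ord_ge (1 + 1)"
    proof (intro ord_ge_sum ord_ge_mult)
      show "b i \<in> ord_ge 1" for i
        unfolding ord_ge_1_iff by (rule S[OF b])
      show "germ_pd i (u j) - germ_const (jacobian_at_0 u $ j $ i) \<in> ord_ge 1" for i
        unfolding ord_ge_1_iff by (simp add: jacobian_at_0_def grad_def)
    qed
    finally show ?thesis
      by (simp add: numeral_2_eq_2)
  qed
  with b show thesis
    by (rule that)
qed

section \<open>Euler derivations\<close>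

definition euler_derivation ::
    "'n::finite germ set \<Rightarrow> 'n germ set \<Rightarrow> ('n germ \<Rightarrow> 'n germ) \<Rightarrow> bool" where
  "euler_derivation S Y D \<longleftrightarrow>
     (\<forall>i. germ_coord i \<in> ideal.span (S \<union> Y)) \<and> (\<forall>y\<in>Y. germ_at_0 y = 0) \<and>
     derivation_mod (ideal.span S) D \<and> (\<forall>h\<in>ideal.span S. D h \<in> ideal.span S) \<and>
     (\<forall>y\<in>Y. \<exists>w>0. D y - w *\<^sub>R y \<in> ideal.span S)"

lemma euler_derivationD:
  assumes "euler_derivation S Y D"
  shows "germ_coord i \<in> ideal.span (S \<union> Y)" "y \<in> Y \<Longrightarrow> germ_at_0 y = 0"
    "derivation_mod (ideal.span S) D" "h \<in> ideal.span S \<Longrightarrow> D h \<in> ideal.span S"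
    "y \<in> Y \<Longrightarrow> \<exists>w>0. D y - w *\<^sub>R y \<in> ideal.span S"
  using assms by (simp_all add: euler_derivation_def)

lemma euler_derivation_imp_vector_field:
  assumes D: "euler_derivation S Y D" and S: "\<And>s. s \<in> S \<Longrightarrow> germ_at_0 s = 0"
  obtains a where "positive_linear_part a"
    "\<And>h. h \<in> ideal.span S \<Longrightarrow> vector_field a h \<in> ideal.span S"
proof -
  define a\<^sub>0 where "a\<^sub>0 i = D (germ_coord i)" for i
  have D_vf: "D g - vector_field a\<^sub>0 g \<in> ideal.span S" for g
    unfolding a\<^sub>0_def by (rule derivation_mod_eq_vector_field[OF euler_derivationD(3)[OF D]])
  have stable: "vector_field a\<^sub>0 h \<in> ideal.span S" if "h \<in> ideal.span S" for h
    using ideal.span_diff[OF euler_derivationD(4)[OF D that] D_vf[of h]] by simp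
  have "germ_at_0 u = 0" if "u \<in> S \<union> Y" for u
    using that S euler_derivationD(2)[OF D] by blast
  then obtain u where u: "local_coordinates u" "\<And>j. u j \<in> S \<union> Y"
    using ex_local_coordinates[OF euler_derivationD(1)[OF D]] by metis
  have "\<exists>l>0. vector_field a\<^sub>0 (u j) - l *\<^sub>R u j \<in> ideal.span S" for j
  proof (cases "u j \<in> S")
    case True
    then show ?thesis
      by (intro exI[of _ 1]) (simp add: ideal.span_diff stable ideal.span_base)
  next
    case False
    then obtain w where w: "w > 0" "D (u j) - w *\<^sub>R u j \<in> ideal.span S"
      using u(2)[of j] euler_derivationD(5)[OF D] by blast
    from ideal.span_diff[OF w(2) D_vf[of "u j"]] w(1) show ?thesis
      by auto
  qed
  then obtain l where l: "\<And>j. 0 < l j" "\<And>j. vector_field a\<^sub>0 (u j) - l j *\<^sub>R u j \<in> ideal.span S"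
    by metis
  have at_0: "germ_at_0 h = 0" if "h \<in> ideal.span S" for h
    using that by (induction rule: ideal.span_induct_alt) (auto simp: S)
  obtain b where b: "\<And>i. b i \<in> ideal.span S"
      "\<And>j. vector_field (\<lambda>i. a\<^sub>0 i + b i) (u j) - l j *\<^sub>R u j \<in> ord_ge 2"
    using ex_diagonal_correction[OF local_coordinatesD(2)[OF u(1)] at_0 l(2)] by blast
  show thesis
  proof (rule that)
    show "positive_linear_part (\<lambda>i. a\<^sub>0 i + b i)"
      using u(1) l(1) b(2) by (auto simp: positive_linear_part_def)
    show "vector_field (\<lambda>i. a\<^sub>0 i + b i) h \<in> ideal.span S" if "h \<in> ideal.span S" for h
      unfolding vector_field_add_coeff
      by (intro ideal.span_add stable that vector_field_in_ideal b(1))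
  qed
qed

lemma euler_derivation_imp_in_coord_multiples:
  assumes D: "euler_derivation S Y D"
    and f: "germ_at_0 f = 0" "\<And>j. germ_pd j f \<in> ideal.span S"
  shows "f \<in> ideal.span (coord_multiples S)"
proof (cases "\<forall>s\<in>S. germ_at_0 s = 0")
  case True
  then obtain a where a: "positive_linear_part a"
      "\<And>h. h \<in> ideal.span S \<Longrightarrow> vector_field a h \<in> ideal.span S"
    using euler_derivation_imp_vector_field[OF D] by blast
  show ?thesis
    by (rule stable_vector_field_imp_in_coord_multiples[OF a f])
next
  case False
  then have "1 \<in> ideal.span S"
    using one_in_ideal ideal.span_base by blast
  moreover have "f \<in> ord_ge 1"
    using f(1) by (simp only: ord_ge_1_iff)
  ultimately show ?thesis
    using ord_ge_1_mult_ideal[of f 1 S] by simp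
qed

theorem euler_derivation_imp_strongly_euler:
  assumes "euler_derivation (insert f (range (\<lambda>i. germ_pd i f))) Y D" "germ_at_0 f = 0"
  shows "f \<in> ideal.span (coord_multiples (range (\<lambda>i. germ_pd i f)))"
proof (rule nakayama)
  have "f \<in> ideal.span (coord_multiples (insert f (range (\<lambda>i. germ_pd i f))))"
    using assms by (intro euler_derivation_imp_in_coord_multiples) (auto intro: ideal.span_base)
  then show "f \<in> ideal.span (coord_multiples (range (\<lambda>i. germ_pd i f)) \<union> coord_multiples {f})"
    by (subst (asm) coord_multiples_insert)
qed

section \<open>From germs to functions\<close>

lemma germ_of_eq_iff:
  assumes "cps g" "cps h"
  shows "germ_of g = germ_of h \<longleftrightarrow> (\<forall>\<^sub>F z in nhds 0. g z = h z)"
  using assms Quotient_rel[OF Quotient_germ, of g h] by auto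

lemma cps_rep_germ: "cps (rep_germ g)"
  using Quotient_rep_reflp[OF Quotient_germ] by blast

lemma germ_of_rep_germ [simp]: "germ_of (rep_germ g) = g"
  by (rule Quotient_abs_rep[OF Quotient_germ])

lemma germ_of_add: "cps g \<Longrightarrow> cps h \<Longrightarrow> germ_of (\<lambda>z. g z + h z) = germ_of g + germ_of h"
  by (simp add: plus_germ.abs_eq eq_onp_def)

lemma germ_of_diff: "cps g \<Longrightarrow> cps h \<Longrightarrow> germ_of (\<lambda>z. g z - h z) = germ_of g - germ_of h"
  by (simp add: minus_germ.abs_eq eq_onp_def)

lemma germ_of_mult: "cps g \<Longrightarrow> cps h \<Longrightarrow> germ_of (\<lambda>z. g z * h z) = germ_of g * germ_of h"
  by (simp add: times_germ.abs_eq eq_onp_def)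

lemma germ_of_const: "germ_of (\<lambda>_. a) = germ_const a"
  by (simp add: germ_const.abs_eq)

lemma germ_of_scaleR: "cps g \<Longrightarrow> germ_of (\<lambda>z. of_real r * g z) = r *\<^sub>R germ_of g"
  by (simp add: scaleR_germ.abs_eq eq_onp_def)

lemma germ_of_coord: "germ_of (\<lambda>z. z $ i) = germ_coord i"
  by (simp add: germ_coord.abs_eq)

lemma germ_of_pd: "cps g \<Longrightarrow> germ_of (pd i g) = germ_pd i (germ_of g)"
  by (simp add: germ_pd.abs_eq eq_onp_def)

lemma germ_at_0_germ_of: "cps g \<Longrightarrow> germ_at_0 (germ_of g) = g 0"
  by (simp add: germ_at_0.abs_eq eq_onp_def)

lemma germ_of_sum:
  "(\<And>x. x \<in> A \<Longrightarrow> cps (g x)) \<Longrightarrow> germ_of (\<lambda>z. \<Sum>x\<in>A. g x z) = (\<Sum>x\<in>A. germ_of (g x))"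
proof (induction A rule: infinite_finite_induct)
  case (insert x F)
  then show ?case
    by (simp add: germ_of_add cps_sum)
qed (simp_all add: germ_of_const)

lemma germ_of_linear_combination:
  assumes "\<And>h. h \<in> F \<Longrightarrow> cps h" "\<And>h. h \<in> F \<Longrightarrow> cps (a h)"
  shows "germ_of (\<lambda>z. \<Sum>h\<in>F. a h z * h z) = (\<Sum>h\<in>F. germ_of (a h) * germ_of h)"
  using assms by (subst germ_of_sum) (auto simp: germ_of_mult cps_mult)

lemma ideal_gen_iff:
  fixes S :: "(complex^'n::finite \<Rightarrow> complex) set"
  assumes S: "S \<subseteq> Collect cps" and g: "cps g"
  shows "ideal_gen S g \<longleftrightarrow> germ_of g \<in> ideal.span (germ_of ` S)"
proof
  assume "ideal_gen S g"
  then obtain F a where F: "finite F" "F \<subseteq> S" "\<And>h. h \<in> F \<Longrightarrow> cps (a h)"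
      "\<forall>\<^sub>F z in nhds 0. g z = (\<Sum>h\<in>F. a h z * h z)"
    by (auto simp: ideal_gen_def)
  have "cps (\<lambda>z. \<Sum>h\<in>F. a h z * h z)"
    using F(2,3) S by (intro cps_sum cps_mult) auto
  then have "germ_of g = germ_of (\<lambda>z. \<Sum>h\<in>F. a h z * h z)"
    using F(4) g by (simp add: germ_of_eq_iff)
  also have "\<dots> = (\<Sum>h\<in>F. germ_of (a h) * germ_of h)"
    using F(2,3) S by (intro germ_of_linear_combination) auto
  also have "\<dots> \<in> ideal.span (germ_of ` S)"
    using F(2) by (intro ideal.span_sum ideal.span_scale ideal.span_base) auto
  finally show "germ_of g \<in> ideal.span (germ_of ` S)" .
next
  assume "germ_of g \<in> ideal.span (germ_of ` S)"
  then obtain t r where t: "finite t" "t \<subseteq> germ_of ` S" "germ_of g = (\<Sum>x\<in>t. r x * x)"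
    unfolding ideal.span_explicit by blast
  obtain F where F: "F \<subseteq> S" "inj_on germ_of F" "t = germ_of ` F"
    using t(2) by (auto simp: subset_image_inj)
  define a where "a h = rep_germ (r (germ_of h))" for h
  have cps: "cps h" "cps (a h)" if "h \<in> F" for h
    using that F(1) S by (auto simp: a_def cps_rep_germ)
  have "germ_of g = (\<Sum>h\<in>F. germ_of (a h) * germ_of h)"
    unfolding t(3) F(3) by (simp add: sum.reindex[OF F(2)] a_def)
  also have "\<dots> = germ_of (\<lambda>z. \<Sum>h\<in>F. a h z * h z)"
    by (rule germ_of_linear_combination[OF cps, symmetric])
  finally have "\<forall>\<^sub>F z in nhds 0. g z = (\<Sum>h\<in>F. a h z * h z)"
    using g cps by (simp add: germ_of_eq_iff cps_sum cps_mult)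
  moreover have "finite F"
    using t(1) F by (simp add: finite_image_iff)
  ultimately show "ideal_gen S g"
    unfolding ideal_gen_def using F(1) cps(2) by blast
qed

lemma congr_iff:
  assumes "S \<subseteq> Collect cps" "cps g" "cps h"
  shows "congr S g h \<longleftrightarrow> germ_of g - germ_of h \<in> ideal.span (germ_of ` S)"
  unfolding congr_def using assms by (subst ideal_gen_iff) (auto simp: cps_diff germ_of_diff)

definition germ_map ::
    "((complex^'n \<Rightarrow> complex) \<Rightarrow> complex^'n \<Rightarrow> complex) \<Rightarrow> 'n::finite germ \<Rightarrow> 'n germ" where
  "germ_map D g = germ_of (D (rep_germ g))"

context
  fixes S :: "(complex^'n::finite \<Rightarrow> complex) set"
    and D :: "(complex^'n \<Rightarrow> complex) \<Rightarrow> complex^'n \<Rightarrow> complex"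
  assumes S: "S \<subseteq> Collect cps" and D: "quot_derivation S D"
begin

lemma quot_derivation_cps: "cps g \<Longrightarrow> cps (D g)"
  using D by (simp add: quot_derivation_def)

lemma germ_map_congr:
  assumes "cps g" "germ_of g - h \<in> ideal.span (germ_of ` S)"
  shows "germ_of (D g) - germ_map D h \<in> ideal.span (germ_of ` S)"
proof -
  have "congr S g (rep_germ h)"
    using assms by (simp add: congr_iff[OF S] cps_rep_germ)
  then have "congr S (D g) (D (rep_germ h))"
    using D assms(1) by (simp add: quot_derivation_def cps_rep_germ)
  then show ?thesis
    using assms(1) by (simp add: congr_iff[OF S] cps_rep_germ quot_derivation_cps germ_map_def)
qed

lemma germ_map_congrI:
  assumes "cps g" "germ_of (D g) - x \<in> ideal.span (germ_of ` S)"
  shows "germ_map D (germ_of g) - x \<in> ideal.span (germ_of ` S)"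
  using ideal.span_diff[OF assms(2) germ_map_congr[OF assms(1), of "germ_of g"]]
  by (simp add: ideal.span_zero)

lemma germ_map_add: "germ_map D (g + h) - (germ_map D g + germ_map D h) \<in> ideal.span (germ_of ` S)"
proof -
  let ?s = "\<lambda>z. rep_germ g z + rep_germ h z"
  have "congr S (D ?s) (\<lambda>z. D (rep_germ g) z + D (rep_germ h) z)"
    using D by (simp add: quot_derivation_def cps_rep_germ)
  then have "germ_of (D ?s) - (germ_map D g + germ_map D h) \<in> ideal.span (germ_of ` S)"
    by (simp add: congr_iff[OF S] quot_derivation_cps cps_add cps_rep_germ germ_of_add germ_map_def)
  from germ_map_congrI[OF _ this] show ?thesis
    by (simp add: cps_add cps_rep_germ germ_of_add)
qed

lemma germ_map_cmult:
  "germ_map D (germ_const c * g) - germ_const c * germ_map D g \<in> ideal.span (germ_of ` S)"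
proof -
  let ?s = "\<lambda>z. c * rep_germ g z"
  have "congr S (D ?s) (\<lambda>z. c * D (rep_germ g) z)"
    using D by (simp add: quot_derivation_def cps_rep_germ)
  then have "germ_of (D ?s) - germ_const c * germ_map D g \<in> ideal.span (germ_of ` S)"
    by (simp add: congr_iff[OF S] quot_derivation_cps cps_cmult cps_const cps_rep_germ germ_of_mult
        germ_of_const germ_map_def)
  from germ_map_congrI[OF _ this] show ?thesis
    by (simp add: cps_cmult cps_const cps_rep_germ germ_of_mult germ_of_const)
qed

lemma germ_map_mult:
  "germ_map D (g * h) - (g * germ_map D h + h * germ_map D g) \<in> ideal.span (germ_of ` S)"
proof -
  let ?s = "\<lambda>z. rep_germ g z * rep_germ h z"
  have "congr S (D ?s) (\<lambda>z. rep_germ g z * D (rep_germ h) z + rep_germ h z * D (rep_germ g) z)"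
    using D by (simp add: quot_derivation_def cps_rep_germ)
  then have "germ_of (D ?s) - (g * germ_map D h + h * germ_map D g) \<in> ideal.span (germ_of ` S)"
    by (simp add: congr_iff[OF S] quot_derivation_cps cps_add cps_mult cps_rep_germ germ_of_add
        germ_of_mult germ_map_def)
  from germ_map_congrI[OF _ this] show ?thesis
    by (simp add: cps_mult cps_rep_germ germ_of_mult)
qed

lemma derivation_mod_germ_map: "derivation_mod (ideal.span (germ_of ` S)) (germ_map D)"
  by (simp add: derivation_mod_def germ_map_add germ_map_cmult germ_map_mult)

lemma germ_map_in_ideal:
  assumes "h \<in> ideal.span (germ_of ` S)"
  shows "germ_map D h \<in> ideal.span (germ_of ` S)"
proof -
  have "germ_map D h - germ_map D 0 \<in> ideal.span (germ_of ` S)"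
    using germ_map_congr[of "rep_germ h" 0] assms by (simp add: cps_rep_germ germ_map_def)
  moreover have "germ_map D 0 \<in> ideal.span (germ_of ` S)"
    using derivation_mod_const[OF derivation_mod_germ_map, of 0] by simp
  ultimately show ?thesis
    using ideal.span_add by fastforce
qed

end

lemma quasihomogeneous_imp_euler_derivation:
  fixes S :: "(complex^'n::finite \<Rightarrow> complex) set"
  assumes S: "S \<subseteq> Collect cps" and "quasihomogeneous S"
  obtains Y D where "euler_derivation (germ_of ` S) Y D"
proof -
  let ?I = "ideal.span (germ_of ` S)"
  obtain ys w D where ys: "min_gens_max S ys" and w: "\<And>i. i < length ys \<Longrightarrow> w i > (0::real)"
    and D: "quot_derivation S D"
    and eigen: "\<And>i. i < length ys \<Longrightarrow> congr S (D (ys ! i)) (\<lambda>z. complex_of_real (w i) * (ys ! i) z)"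
    using assms(2) unfolding quasihomogeneous_def by blast
  have ys_max: "cps y" "y 0 = 0" if "y \<in> set ys" for y
    using ys that by (auto simp: min_gens_max_def gens_max_def max_ideal_def)
  have "germ_coord i \<in> ideal.span (germ_of ` S \<union> germ_of ` set ys)" for i
  proof -
    have "ideal_gen (S \<union> set ys) (\<lambda>z. z $ i)"
      using ys by (simp add: min_gens_max_def gens_max_def max_ideal_def cps_coord)
    then show ?thesis
      using S ys_max by (subst (asm) ideal_gen_iff) (auto simp: cps_coord germ_of_coord image_Un)
  qed
  moreover have "\<exists>v>0. germ_map D (germ_of y) - v *\<^sub>R germ_of y \<in> ?I" if y: "y \<in> set ys" for y
  proof -
    obtain i where i: "i < length ys" "y = ys ! i"
      using y by (auto simp: in_set_conv_nth)
    have "germ_of (D y) - w i *\<^sub>R germ_of y \<in> ?I"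
      using eigen[OF i(1)] ys_max(1)[OF y] quot_derivation_cps[OF S D]
      by (simp add: congr_iff[OF S] cps_cmult germ_of_scaleR i(2))
    then show ?thesis
      using germ_map_congrI[OF S D ys_max(1)[OF y]] w[OF i(1)] by blast
  qed
  ultimately have "euler_derivation (germ_of ` S) (germ_of ` set ys) (germ_map D)"
    using ys_max derivation_mod_germ_map[OF S D] germ_map_in_ideal[OF S D]
    by (auto simp: euler_derivation_def germ_at_0_germ_of)
  then show thesis
    by (rule that)
qed

lemma sing_gens_cps: "cps f \<Longrightarrow> sing_gens f \<subseteq> Collect cps"
  by (auto simp: sing_gens_def cps_pd)

lemma germ_of_sing_gens:
  "cps f \<Longrightarrow> germ_of ` sing_gens f = insert (germ_of f) (range (\<lambda>i. germ_pd i (germ_of f)))"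
  by (auto simp: sing_gens_def image_image germ_of_pd)

lemma strongly_euler_homogeneous_iff:
  assumes "cps f"
  shows "strongly_euler_homogeneous f \<longleftrightarrow>
    germ_of f \<in> ideal.span (coord_multiples (range (\<lambda>i. germ_pd i (germ_of f))))"
proof -
  have "germ_of ` {(\<lambda>z. z $ j * pd i f z) | i j. True} =
      {germ_of (\<lambda>z. z $ j * pd i f z) | i j. True}"
    by blast
  also have "\<dots> = {germ_coord j * germ_pd i (germ_of f) | i j. True}"
    using assms by (simp only: germ_of_mult cps_coord cps_pd germ_of_coord germ_of_pd)
  also have "\<dots> = coord_multiples (range (\<lambda>i. germ_pd i (germ_of f)))"
    unfolding coord_multiples_def by blast
  finally have "germ_of ` {(\<lambda>z. z $ j * pd i f z) | i j. True} =
      coord_multiples (range (\<lambda>i. germ_pd i (germ_of f)))" .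
  moreover have "{(\<lambda>z. z $ j * pd i f z) | i j. True} \<subseteq> Collect cps"
    using assms by (auto intro: cps_mult cps_coord cps_pd)
  ultimately show ?thesis
    unfolding strongly_euler_homogeneous_def using assms by (simp add: ideal_gen_iff)
qed

theorem theorem4p6:
  fixes f :: "complex^'n::finite \<Rightarrow> complex"
  assumes "cps f"
    and "\<not> (\<forall>\<^sub>F z in nhds 0. f z = 0)"
    and "f 0 = 0"
    and "quasihomogeneous (sing_gens f)"
  shows "strongly_euler_homogeneous f"
proof -
  obtain Y D where "euler_derivation (germ_of ` sing_gens f) Y D"
    by (rule quasihomogeneous_imp_euler_derivation[OF sing_gens_cps[OF assms(1)] assms(4)])
  moreover have "germ_at_0 (germ_of f) = 0"
    using assms(1,3) by (simp add: germ_at_0_germ_of)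
  ultimately have "germ_of f \<in> ideal.span (coord_multiples (range (\<lambda>i. germ_pd i (germ_of f))))"
    unfolding germ_of_sing_gens[OF assms(1)] by (rule euler_derivation_imp_strongly_euler)
  then show ?thesis
    by (simp only: strongly_euler_homogeneous_iff[OF assms(1)])
qed

end
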